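(* Let $(x,\lambda):[t_0,\infty)\to\mathbb{R}^n\times\mathbb{R}^m$ be a solution (with $x\in C^2$, $\lambda\in C^1$) of the dynamical system $$ \begin{aligned} &\ddot x(t)+\delta\sqrt{\varepsilon(t)}\,\dot x(t)+\nabla f\bigl(x(t)+\beta(t)\dot x(t)\bigr)+A^\top\lambda(t)+\rho A^\top\bigl(A(x(t)+\beta(t)\dot x(t))-b\bigr)+\varepsilon(t)x(t)=0,\\ &\dot\lambda(t)=\frac{\gamma}{\sqrt{\varepsilon(t)}}\Bigl[A\Bigl(x(t)+\frac{\gamma}{\sigma\sqrt{\varepsilon(t)}}\dot x(t)\Bigr)-b\Bigr], \end{aligned} $$ where the data satisfy the standing assumptions of the context. Let $x^*=P_S(0)$ and let $\lambda^\dagger\in\mathbb{R}^m$ be the multiplier with $\nabla f(x^* )+A^\top\lambda^\dagger=0$ and $\lambda(t_0)-\lambda^\dagger\in\operatorname{Ran}A$. Assume that there exist $s_T\in[0,s_\infty)$ and $\eta_1,\eta_2>0$ such that for all $s\in[s_T,s_\infty)$: $$ p(s)<2\Bigl(\delta-\frac{\sigma}{\gamma}\Bigr),\qquad \frac{\sigma}{\gamma}-p(s)\ge\eta_1,\qquad \delta-\frac{\sigma}{\gamma}-\frac{p(s)}{2}-\frac{\sigma L}{2\gamma}\beta(t(s))^2\ge\eta_2,\qquad \frac{\sigma}{4\gamma}(-p'(s))_+\le\frac{\sigma/\gamma+p(s)}{8}. $$ Then $$x(t)\to x^*\quad\text{and}\quad\lambda(t)\to\lambda^\dagger\qquad\text{as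 }t\to\infty.$$
   Context: Standing assumptions: $t_0>0$; $f:\mathbb{R}^n\to\mathbb{R}$ is convex and continuously differentiable with $L$-Lipschitz gradient, $L>0$; $A\in\mathbb{R}^{m\times n}$, $b\in\mathbb{R}^m$; $\delta,\rho,\sigma,\gamma>0$; $\varepsilon\in C^2([t_0,\infty);(0,\infty))$ is nonincreasing with $\varepsilon(t)\to0$ as $t\to\infty$; $\beta:[t_0,\infty)\to[0,\infty)$ is continuous and bounded. The solution set $S:=\operatorname{argmin}\{f(x):Ax=b\}$ is nonempty, and $P_S(0)$ denotes its minimum-norm element (projection of $0$ onto the closed convex set $S$). A multiplier $\lambda^\dagger$ with the two stated properties always exists and is unique. Time change: $s(t):=\int_{t_0}^t\sqrt{\varepsilon(u)}\,du$, $s_\infty:=\int_{t_0}^\infty\sqrt{\varepsilon(u)}\,du\in(0,\infty]$; $t(s)$ is the inverse of the strictly increasing map $s:[t_0,\infty)\to[0,s_\infty)$; $a(s):=1/\varepsilon(t(s))$; $p(s):=a'(s)/a(s)=-\dot\varepsilon(t(s))/\varepsilon(t(s))^{3/2}$; $p'$ is the derivative of $p$ with respect to $s$. Notation $(r)_+:=\max\{r,0\}$. *)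

theory Defs
  imports "HOL-Analysis.Analysis"
begin

text \<open>
  Derivatives of functions defined on an interval \<open>I\<close> are taken within \<open>I\<close>, so they are
  one-sided at an endpoint belonging to \<open>I\<close> and do not depend on the values outside \<open>I\<close>.
\<close>

definition deriv_on :: "real set \<Rightarrow> (real \<Rightarrow> 'a::real_normed_vector) \<Rightarrow> real \<Rightarrow> 'a" where
  "deriv_on I g t = vector_derivative g (at t within I)"

definition C1_on :: "real set \<Rightarrow> (real \<Rightarrow> 'a::real_normed_vector) \<Rightarrow> bool" where
  "C1_on I g \<longleftrightarrow> g differentiable_on I \<and> continuous_on I (deriv_on I g)"

definition C2_on :: "real set \<Rightarrow> (real \<Rightarrow> 'a::real_normed_vector) \<Rightarrow> bool" where
  "C2_on I g \<longleftrightarrow> g differentiable_on I \<and> C1_on I (deriv_on I g)"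

definition solution_set ::
  "(real ^ 'n \<Rightarrow> real) \<Rightarrow> real ^ 'n ^ 'm \<Rightarrow> real ^ 'm \<Rightarrow> (real ^ 'n) set" where
  "solution_set f A b = {x. is_arg_min f (\<lambda>z. A *v z = b) x}"

definition s_of :: "real \<Rightarrow> (real \<Rightarrow> real) \<Rightarrow> real \<Rightarrow> real" where
  "s_of t0 eps t = integral {t0..t} (\<lambda>u. sqrt (eps u))"

definition s_inf :: "real \<Rightarrow> (real \<Rightarrow> real) \<Rightarrow> ennreal" where
  "s_inf t0 eps = (\<integral>\<^sup>+u\<in>{t0..}. ennreal (sqrt (eps u)) \<partial>lborel)"

text \<open>The interval \<open>[0, s_inf)\<close>, whose right endpoint may be infinite.\<close>

definition s_dom :: "real \<Rightarrow> (real \<Rightarrow> real) \<Rightarrow> real set" where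
  "s_dom t0 eps = {s. 0 \<le> s \<and> ennreal s < s_inf t0 eps}"

definition t_of :: "real \<Rightarrow> (real \<Rightarrow> real) \<Rightarrow> real \<Rightarrow> real" where
  "t_of t0 eps = the_inv_into {t0..} (s_of t0 eps)"

definition a_fun :: "real \<Rightarrow> (real \<Rightarrow> real) \<Rightarrow> real \<Rightarrow> real" where
  "a_fun t0 eps s = 1 / eps (t_of t0 eps s)"

definition p_fun :: "real \<Rightarrow> (real \<Rightarrow> real) \<Rightarrow> real \<Rightarrow> real" where
  "p_fun t0 eps s = deriv_on (s_dom t0 eps) (a_fun t0 eps) s / a_fun t0 eps s"

definition p_deriv :: "real \<Rightarrow> (real \<Rightarrow> real) \<Rightarrow> real \<Rightarrow> real" where
  "p_deriv t0 eps = deriv_on (s_dom t0 eps) (p_fun t0 eps)"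

end

theory Submission
  imports Defs
begin

text \<open>
  In the rescaled time, the energy (shifted Lagrangian times \<open>a\<close>, plus squared distances of state, velocity
  and multiplier) dissipates everything except the multiplier error \<open>\<nu>\<close>. Adding a small multiple of the
  cross term \<open>(A v \<bullet> \<nu>) / a\<close>, where \<open>v\<close> is \<open>\<sigma> / \<gamma>\<close> times the state error plus the velocity, makes
  \<open>\<nu>\<close> dissipate as well, because \<open>\<nu>\<close> stays in the range of \<open>A\<close>,
  where \<open>adjoint A\<close> is bounded below. The resulting functional \<open>F\<close> satisfies \<open>F' \<le> - \<omega> F + o(1)\<close>; the error
  \<open>o(1)\<close> is the Tikhonov gap, which vanishes as \<open>a \<rightarrow> \<infinity>\<close> because the limit is the minimal-norm solution.
  As \<open>p < \<sigma> / \<gamma>\<close>, the function \<open>a\<close> grows at most exponentially in the rescaled time, so the latter is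
  unbounded and Gronwall's inequality applies. No integrability of the Tikhonov gap is needed.
\<close>

section \<open>Convex functions, linear maps and derivatives\<close>

text \<open>Rescaling by \<open>w = sqrt \<epsilon>\<close> makes the Tikhonov coefficient 1 and the
  damping \<open>\<delta> - p / 2\<close>, at the price of a factor
  \<open>a = 1 / \<epsilon>\<close> on the gradient of the Lagrangian. The value
  \<open>\<kappa> = \<sigma> / \<gamma>\<close> is dictated by the multiplier equation: it is driven
  by the state error plus velocity over \<open>\<kappa>\<close>, that is by
  \<open>v / \<kappa>\<close>, so pairing the state equation with \<open>v\<close> makes the
  multiplier terms of the energy cancel exactly. The assumed inequalities give the signs of what
  remains: \<open>\<kappa> - p\<close> for the gap weighted by the growing \<open>a\<close>, the
  damping inequality for the kinetic term after the loss caused by the extrapolation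
  \<open>\<beta>\<close>, and the bound on the derivative of \<open>p\<close> for the moving
  coefficient of the squared state error. The obstacle is that the multiplier equation has no
  dissipation of its own. Dividing the cross term by \<open>a\<close> normalises the force
  \<open>a *\<^sub>R adjoint A \<nu>\<close>; its cost is then a constant times the gap, the squared
  velocity, and (squared state error + 1) over \<open>a\<close>. The energy dissipates these up to a
  vanishing remainder, so one small multiple serves for all large times.\<close>

lemma has_real_derivative_inner:
  fixes f g :: "real \<Rightarrow> 'a::real_inner"
  assumes "(f has_vector_derivative f') (at t within S)" "(g has_vector_derivative g') (at t within S)"
  shows "((\<lambda>t. f t \<bullet> g t) has_real_derivative f t \<bullet> g' + f' \<bullet> g t) (at t within S)"
  using bounded_bilinear.has_vector_derivative[OF bounded_bilinear_inner assms]
  by (simp add: has_real_derivative_iff_has_vector_derivative)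

lemma GDERIV_compose_vector_derivative:
  fixes f :: "'a::real_inner \<Rightarrow> real"
  assumes "GDERIV f (g t) :> D" "(g has_vector_derivative g') (at t within S)"
  shows "((\<lambda>t. f (g t)) has_real_derivative g' \<bullet> D) (at t within S)"
proof -
  have "((\<lambda>t. f (g t)) has_derivative (\<lambda>h. (h *\<^sub>R g') \<bullet> D)) (at t within S)"
    using assms has_derivative_compose[of g "\<lambda>h. h *\<^sub>R g'" t S f "\<lambda>h. h \<bullet> D"]
    by (simp add: gderiv_def has_vector_derivative_def)
  then show ?thesis
    by (simp add: has_field_derivative_def mult_commute_abs)
qed

lemma GDERIV_along_line:
  fixes f :: "'a::real_inner \<Rightarrow> real"
  assumes "\<And>z. GDERIV f z :> G z"
  shows "((\<lambda>r. f (x + r *\<^sub>R d)) has_real_derivative d \<bullet> G (x + r *\<^sub>R d)) (at r within S)"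
  by (rule GDERIV_compose_vector_derivative[OF assms]) (auto intro!: derivative_eq_intros)

text \<open>Restriction to the line through \<open>x\<close> and \<open>y\<close> reduces the claim
  to the tangent inequality for a convex function of one real variable.\<close>

lemma convex_gradient_le:
  fixes f :: "'a::real_inner \<Rightarrow> real"
  assumes f: "convex_on UNIV f" and G: "\<And>z. GDERIV f z :> G z"
  shows "f x + G x \<bullet> (y - x) \<le> f y"
proof -
  define h where "h r = f (x + r *\<^sub>R (y - x))" for r
  have "convex_on UNIV h"
  proof (rule convex_onI)
    fix t r s :: real assume t: "0 < t" "t < 1"
    have "x + ((1 - t) *\<^sub>R r + t *\<^sub>R s) *\<^sub>R (y - x) =
        (1 - t) *\<^sub>R (x + r *\<^sub>R (y - x)) + t *\<^sub>R (x + s *\<^sub>R (y - x))"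
      by (simp add: algebra_simps)
    then show "h ((1 - t) *\<^sub>R r + t *\<^sub>R s) \<le> (1 - t) * h r + t * h s"
      using convex_onD[OF f, of t] t unfolding h_def by simp
  qed auto
  moreover have "(h has_real_derivative (y - x) \<bullet> G x) (at 0)"
    using GDERIV_along_line[OF G, of x "y - x" 0 UNIV] by (simp add: h_def[abs_def])
  ultimately have "h 1 - h 0 \<ge> ((y - x) \<bullet> G x) * (1 - 0)"
    using convex_on_imp_above_tangent[of UNIV h 0 1 "(y - x) \<bullet> G x"] by auto
  then show ?thesis by (simp add: h_def inner_commute)
qed

text \<open>Subtracting the quadratic model along the segment leaves a function \<open>h\<close>
  whose derivative is nonpositive by Cauchy-Schwarz and the Lipschitz bound.\<close>

lemma lipschitz_gradient_upper_bound:
  fixes f :: "'a::real_inner \<Rightarrow> real"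
  assumes G: "\<And>z. GDERIV f z :> G z" and L: "L-lipschitz_on UNIV G"
  shows "f y \<le> f x + G x \<bullet> (y - x) + L / 2 * (norm (y - x))\<^sup>2"
proof -
  define h where "h r = f (x + r *\<^sub>R (y - x)) - r * (G x \<bullet> (y - x)) - L / 2 * r\<^sup>2 * (norm (y - x))\<^sup>2" for r
  have "h 1 \<le> h 0"
  proof (rule DERIV_nonpos_imp_nonincreasing[of 0 1 h])
    fix r :: real assume r: "0 \<le> r" "r \<le> 1"
    have "(h has_real_derivative
        (y - x) \<bullet> G (x + r *\<^sub>R (y - x)) - G x \<bullet> (y - x) - L * r * (norm (y - x))\<^sup>2) (at r)"
      unfolding h_def by (auto intro!: derivative_eq_intros GDERIV_along_line[OF G])
    moreover have "(y - x) \<bullet> G (x + r *\<^sub>R (y - x)) - G x \<bullet> (y - x) - L * r * (norm (y - x))\<^sup>2 \<le> 0"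
    proof -
      have "(y - x) \<bullet> (G (x + r *\<^sub>R (y - x)) - G x) \<le> norm (y - x) * norm (G (x + r *\<^sub>R (y - x)) - G x)"
        by (rule norm_cauchy_schwarz)
      also have "\<dots> \<le> norm (y - x) * (L * (r * norm (y - x)))"
        using lipschitz_onD[OF L, of "x + r *\<^sub>R (y - x)" x] r
        by (intro mult_left_mono) (auto simp: dist_norm)
      finally show ?thesis by (simp add: inner_diff_right inner_commute power2_eq_square algebra_simps)
    qed
    ultimately show "\<exists>d. DERIV h r :> d \<and> d \<le> 0" by blast
  qed simp
  then show ?thesis by (simp add: h_def)
qed

text \<open>A gradient step of length \<open>1 / L\<close> lowers \<open>f\<close> by at least the
  squared gradient norm over \<open>2 * L\<close>, and \<open>f\<close> cannot fall below 0.\<close>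

lemma gradient_norm_le_gap:
  fixes f :: "'a::real_inner \<Rightarrow> real"
  assumes G: "\<And>z. GDERIV f z :> G z" and L: "L-lipschitz_on UNIV G" "L > 0"
    and nonneg: "\<And>z. 0 \<le> f z"
  shows "(norm (G x))\<^sup>2 \<le> 2 * L * f x"
proof -
  have "0 \<le> f x + G x \<bullet> (- (1 / L) *\<^sub>R G x) + L / 2 * (norm ((1 / L) *\<^sub>R G x))\<^sup>2"
    using lipschitz_gradient_upper_bound[OF G L(1), where y="x - (1 / L) *\<^sub>R G x" and x=x]
      nonneg[of "x - (1 / L) *\<^sub>R G x"] by simp
  also have "\<dots> = f x - (norm (G x))\<^sup>2 / (2 * L)"
    using L(2) by (simp add: power_mult_distrib dot_square_norm divide_simps power2_eq_square)
  finally show ?thesis using L(2) by (simp add: field_simps)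
qed

text \<open>The kernel of the adjoint is orthogonal to the range of \<open>A\<close>, so the adjoint
  is injective there; in finite dimension injectivity gives a uniform lower bound. No surjectivity
  of \<open>A\<close> is involved.\<close>

lemma linear_bounded_below_range_adjoint:
  fixes A :: "'a::euclidean_space \<Rightarrow> 'b::euclidean_space"
  assumes "linear A"
  shows "\<exists>e>0. \<forall>y\<in>range A. e * norm y \<le> norm (adjoint A y)"
proof -
  have "\<forall>y\<in>range A. adjoint A y = 0 \<longrightarrow> y = 0"
  proof (intro ballI impI)
    fix y assume y: "y \<in> range A" "adjoint A y = 0"
    obtain z where "y = A z" using y(1) by blast
    then have "y \<bullet> y = z \<bullet> adjoint A y" by (simp add: adjoint_works[OF assms])
    then show "y = 0" using y(2) by simp
  qed
  then show ?thesis
    using injective_imp_isometric[OF closed_subspace, of "range A" "adjoint A"]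
      linear_subspace_image[OF assms subspace_UNIV] adjoint_linear[OF assms]
    unfolding linear_conv_bounded_linear by presburger
qed

text \<open>The part of \<open>g t\<close> orthogonal to \<open>V\<close> is taken at the final time
  and frozen as \<open>z\<close>. The scalar \<open>z \<bullet> g r\<close> is then constant in
  \<open>r\<close> and vanishes at \<open>t0\<close>, hence \<open>z = 0\<close>.\<close>

lemma stays_in_subspace:
  fixes g :: "real \<Rightarrow> 'a::euclidean_space"
  assumes V: "subspace V" and gt0: "g t0 \<in> V" and le: "t0 \<le> t"
    and g: "\<And>r. t0 \<le> r \<Longrightarrow> (g has_vector_derivative g' r) (at r within {t0..})"
    and g': "\<And>r. t0 \<le> r \<Longrightarrow> g' r \<in> V"
  shows "g t \<in> V"
proof (cases "t = t0")
  case False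
  have V': "span V = V" using V by (simp add: span_eq_iff)
  obtain y z where yz: "y \<in> V" "\<And>v. v \<in> V \<Longrightarrow> z \<bullet> v = 0" "g t = y + z"
    using orthogonal_subspace_decomp_exists[of V "g t"] unfolding V' orthogonal_def by metis
  have "continuous_on {t0..} g"
    unfolding continuous_on_eq_continuous_within
    by (intro ballI has_vector_derivative_continuous[OF g]) simp
  then have cont: "continuous_on {t0..t} g"
    by (rule continuous_on_subset) simp
  have "z \<bullet> g t = z \<bullet> g t0"
  proof (rule DERIV_isconst_end[where f="\<lambda>r. z \<bullet> g r"])
    show "t0 < t" using False le by simp
    show "continuous_on {t0..t} (\<lambda>r. z \<bullet> g r)"
      by (intro continuous_intros cont)
    fix r assume r: "t0 < r" "r < t"
    have "((\<lambda>r. z \<bullet> g r) has_real_derivative z \<bullet> g' r + 0 \<bullet> g r) (at r within {t0..})"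
      by (rule has_real_derivative_inner[OF has_vector_derivative_const g]) (use r in simp)
    moreover have "z \<bullet> g' r = 0" by (rule yz(2)[OF g']) (use r in simp)
    moreover have "at r within {t0..} = at r" by (rule at_within_interior) (use r in simp)
    ultimately show "((\<lambda>r. z \<bullet> g r) has_real_derivative 0) (at r)"
      by simp
  qed
  also have "\<dots> = 0" by (rule yz(2)[OF gt0])
  finally have "z \<bullet> z = 0" using yz(2)[OF yz(1)] by (simp add: yz(3) inner_add_right)
  then show ?thesis using yz(1,3) by simp
qed (simp add: gt0)

section \<open>The time change\<close>

lemma deriv_on_at:
  assumes "g differentiable_on I" "t \<in> interior I"
  shows "(g has_vector_derivative deriv_on I g t) (at t)"
proof -
  have "t \<in> I" using assms(2) interior_subset by blast
  then have "(g has_vector_derivative deriv_on I g t) (at t within I)"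
    using assms(1) unfolding deriv_on_def differentiable_on_def by (simp add: vector_derivative_works)
  then show ?thesis using assms(2) by (simp add: at_within_interior[of t I])
qed

lemma deriv_on_eqI:
  assumes "t \<in> interior I" "(g has_vector_derivative d) (at t)"
  shows "deriv_on I g t = d"
  using assms by (simp add: deriv_on_def at_within_interior[of t I] vector_derivative_at)

locale time_change =
  fixes t0 :: real and eps :: "real \<Rightarrow> real"
  assumes cont: "continuous_on {t0..} eps"
    and pos: "\<And>t. t0 \<le> t \<Longrightarrow> 0 < eps t"
begin

abbreviation "w \<equiv> \<lambda>t. sqrt (eps t)"
abbreviation "s \<equiv> s_of t0 eps"
abbreviation "I \<equiv> s_dom t0 eps"

lemma s_zero [simp]: "s t0 = 0"
  by (simp add: s_of_def)

lemma s_deriv_within: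
  assumes "t0 \<le> t"
  shows "(s has_real_derivative w t) (at t within {t0..})"
proof -
  have "((\<lambda>x. integral {t0..x} w) has_vector_derivative w t) (at t within {t0..t + 1})"
    using assms by (intro integral_has_vector_derivative continuous_intros continuous_on_subset[OF cont]) auto
  moreover have "at t within {t0..t + 1} = at t within {t0..}"
    by (rule at_within_nhd[of t "{..<t + 1}"]) auto
  ultimately show ?thesis
    by (simp add: s_of_def[abs_def] has_real_derivative_iff_has_vector_derivative)
qed

lemma s_deriv:
  assumes "t0 < t"
  shows "(s has_real_derivative w t) (at t)"
  using s_deriv_within[of t] assms by (simp add: at_within_interior[of t "{t0..}"])

lemma s_cont: "continuous_on {t0..} s"
  unfolding continuous_on_eq_continuous_within
  by (intro ballI DERIV_continuous[OF s_deriv_within]) simp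

lemma s_less:
  assumes "t0 \<le> t" "t < t'"
  shows "s t < s t'"
proof (rule DERIV_pos_imp_increasing_open[OF assms(2)])
  show "continuous_on {t..t'} s"
    using assms by (intro continuous_on_subset[OF s_cont]) auto
  fix r assume "t < r" "r < t'"
  then show "\<exists>d. (s has_real_derivative d) (at r) \<and> 0 < d"
    using assms s_deriv[of r] pos[of r] by (intro exI[of _ "w r"]) auto
qed

lemma s_inj: "inj_on s {t0..}"
proof (rule inj_onI)
  fix r r' assume "r \<in> {t0..}" "r' \<in> {t0..}" "s r = s r'"
  then show "r = r'" using s_less[of r r'] s_less[of r' r] by (cases r r' rule: linorder_cases) auto
qed

lemma t_of_s: "t0 \<le> t \<Longrightarrow> t_of t0 eps (s t) = t"
  unfolding t_of_def by (rule the_inv_into_f_f[OF s_inj]) auto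

text \<open>Bridges the two integrals in play: \<open>s_of\<close> is a gauge integral, whereas
  \<open>s_inf\<close> is a nonnegative Lebesgue integral that may be infinite.\<close>

lemma ennreal_s:
  assumes "t0 \<le> t"
  shows "ennreal (s t) = (\<integral>\<^sup>+u\<in>{t0..t}. ennreal (w u) \<partial>lborel)"
proof -
  \<comment> \<open>Constant continuation to the left of \<open>t0\<close>, together with the lower
    limit \<open>t0 - 1\<close>, makes the primitive differentiable from both sides also at
    \<open>t0\<close>.\<close>
  define e where "e u = eps (max t0 u)" for u
  have e: "continuous_on UNIV e" unfolding e_def
    by (intro continuous_on_compose2[OF cont]) (auto intro!: continuous_intros)
  define F where "F u = integral {t0 - 1..u} (\<lambda>x. sqrt (e x))" for u
  have "(F has_real_derivative sqrt (e u)) (at u)" if "u \<in> {t0..t}" for u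
  proof -
    have "(F has_vector_derivative sqrt (e u)) (at u within {t0 - 1..t + 1})"
      unfolding F_def using that
      by (intro integral_has_vector_derivative continuous_intros continuous_on_subset[OF e]) auto
    then show ?thesis using that
      by (simp add: at_within_interior[of u "{t0 - 1..t + 1}"] has_real_derivative_iff_has_vector_derivative)
  qed
  moreover have "0 \<le> sqrt (e u)" for u using pos[of "max t0 u"] by (simp add: e_def)
  moreover have "(\<lambda>u. sqrt (e u)) \<in> borel_measurable borel"
    by (intro borel_measurable_continuous_onI continuous_intros e)
  ultimately have "(\<integral>\<^sup>+u. ennreal (sqrt (e u)) * indicator {t0..t} u \<partial>lborel) = ennreal (F t - F t0)"
    using assms by (intro nn_integral_FTC_Icc) auto
  also have "F t - F t0 = integral {t0..t} (\<lambda>x. sqrt (e x))"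
  proof -
    have "(\<lambda>x. sqrt (e x)) integrable_on {t0 - 1..t}"
      by (intro integrable_continuous_interval continuous_intros continuous_on_subset[OF e]) auto
    then show ?thesis unfolding F_def
      using Henstock_Kurzweil_Integration.integral_combine[of "t0 - 1" t0 t "\<lambda>x. sqrt (e x)"] assms
      by simp
  qed
  also have "\<dots> = s t" unfolding s_of_def
    by (intro integral_cong) (auto simp: e_def max_def)
  finally show ?thesis
    by (subst nn_integral_cong[where v="\<lambda>u. ennreal (sqrt (e u)) * indicator {t0..t} u"])
      (auto simp: e_def max_def indicator_def)
qed

lemma s_inf_eq_SUP: "s_inf t0 eps = (SUP n. ennreal (s (t0 + real n)))"
proof -
  have m: "(\<lambda>u. ennreal (w u) * indicator {t0..t0 + real n} u) \<in> borel_measurable lborel" for n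
  proof -
    have "continuous_on {t0..t0 + real n} w"
      by (intro continuous_intros continuous_on_subset[OF cont]) auto
    then have "(\<lambda>u. if u \<in> {t0..t0 + real n} then w u else 0) \<in> borel_measurable borel"
      by (intro borel_measurable_continuous_on_if) auto
    then have "(\<lambda>u. ennreal (if u \<in> {t0..t0 + real n} then w u else 0)) \<in> borel_measurable lborel"
      by simp
    also have "(\<lambda>u. ennreal (if u \<in> {t0..t0 + real n} then w u else 0)) =
        (\<lambda>u. ennreal (w u) * indicator {t0..t0 + real n} u)"
      by (auto simp: indicator_def fun_eq_iff)
    finally show ?thesis .
  qed
  have "s_inf t0 eps = (\<integral>\<^sup>+u. (SUP n. ennreal (w u) * indicator {t0..t0 + real n} u) \<partial>lborel)"
    unfolding s_inf_def
  proof (rule nn_integral_cong)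
    fix u :: real
    show "ennreal (w u) * indicator {t0..} u = (SUP n. ennreal (w u) * indicator {t0..t0 + real n} u)"
    proof (rule antisym)
      obtain n where "u \<le> t0 + real n" using real_arch_simple[of "u - t0"] by (auto simp: algebra_simps)
      then have "ennreal (w u) * indicator {t0..} u = ennreal (w u) * indicator {t0..t0 + real n} u"
        by (auto simp: indicator_def)
      then show "ennreal (w u) * indicator {t0..} u \<le> (SUP n. ennreal (w u) * indicator {t0..t0 + real n} u)"
        by (auto intro: SUP_upper2)
    qed (auto intro!: SUP_least simp: indicator_def)
  qed
  also have "\<dots> = (SUP n. \<integral>\<^sup>+u. ennreal (w u) * indicator {t0..t0 + real n} u \<partial>lborel)"
    by (rule nn_integral_monotone_convergence_SUP[OF _ m])
      (auto simp: incseq_def le_fun_def indicator_def)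
  finally show ?thesis by (simp add: ennreal_s)
qed

text \<open>Points below the supremum are reached by the intermediate value theorem; the supremum
  itself is not attained because \<open>s\<close> is strictly increasing. Conditions on the rescaled
  interval thereby become conditions on \<open>t\<close>.\<close>

lemma s_dom_eq: "I = s ` {t0..}"
proof safe
  fix r assume "r \<in> I"
  then have r: "0 \<le> r" "ennreal r < (SUP n. ennreal (s (t0 + real n)))"
    by (auto simp: s_dom_def s_inf_eq_SUP)
  then obtain n where "ennreal r < ennreal (s (t0 + real n))"
    by (auto simp: less_SUP_iff)
  then have "r \<le> s (t0 + real n)" using r(1) by (auto simp: ennreal_less_iff)
  moreover have "continuous_on {t0..t0 + real n} s" by (intro continuous_on_subset[OF s_cont]) auto
  ultimately obtain t where "t0 \<le> t" "s t = r"
    using IVT'[of s t0 r "t0 + real n"] r(1) by auto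
  then show "r \<in> s ` {t0..}" by auto
next
  fix t assume t: "t0 \<le> t"
  have "0 \<le> s t" using s_less[of t0 t] t by (cases "t = t0") auto
  obtain n where "t < t0 + real n" using reals_Archimedean2[of "t - t0"] by (auto simp: algebra_simps)
  then have "ennreal (s t) < ennreal (s (t0 + real n))"
    using t s_less[of t "t0 + real n"] \<open>0 \<le> s t\<close> by (auto simp: ennreal_less_iff)
  also have "\<dots> \<le> s_inf t0 eps" unfolding s_inf_eq_SUP by (rule SUP_upper) auto
  finally show "s t \<in> I" using \<open>0 \<le> s t\<close> by (simp add: s_dom_def)
qed

text \<open>The chain rule for the inverse time change: differentiating in rescaled time means
  dividing the \<open>t\<close>-derivative by \<open>w\<close>. Agreement of \<open>h\<close> with
  \<open>g\<close> is asked only past \<open>t0\<close>, which allows a second application to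
  \<open>p_fun\<close>.\<close>

lemma deriv_on_s_dom:
  assumes t: "t0 < t" and g: "(g has_vector_derivative d) (at t)"
    and h: "\<And>r. t0 < r \<Longrightarrow> h (s r) = g r"
  shows "deriv_on I h (s t) = (1 / w t) *\<^sub>R d"
proof (rule deriv_on_eqI)
  \<comment> \<open>The midpoint keeps a whole neighbourhood of \<open>t\<close> strictly to the
    right of \<open>t0\<close>, where \<open>s\<close> has a two-sided derivative.\<close>
  let ?a = "(t0 + t) / 2"
  have at: "t0 < ?a" "?a < t" using t by auto
  have lt: "s ?a < s t" "s t < s (t + 1)" using s_less at by auto
  have img: "{s ?a<..<s (t + 1)} \<subseteq> s ` {?a..t + 1}"
  proof
    fix r assume "r \<in> {s ?a<..<s (t + 1)}"
    moreover have "continuous_on {?a..t + 1} s" using at by (intro continuous_on_subset[OF s_cont]) auto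
    ultimately obtain x where "?a \<le> x" "x \<le> t + 1" "s x = r"
      using IVT'[of s ?a r "t + 1"] at by auto
    then show "r \<in> s ` {?a..t + 1}" by auto
  qed
  then have "{s ?a<..<s (t + 1)} \<subseteq> I" unfolding s_dom_eq using at by force
  then show "s t \<in> interior I" using lt by (intro interiorI[of "{s ?a<..<s (t + 1)}"]) auto
  let ?T = "t_of t0 eps"
  have sT: "s (?T r) = r" "t0 < ?T r" if "r \<in> {s ?a<..<s (t + 1)}" for r
    using img that at t_of_s by fastforce+
  have "(?T has_real_derivative inverse (w t)) (at (s t))"
  proof (rule DERIV_inverse_function[where f=s])
    show "(s has_real_derivative w t) (at (?T (s t)))" using t s_deriv by (simp add: t_of_s)
    show "w t \<noteq> 0" using pos[of t] t by simp
    show "isCont ?T (s t)"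
    proof (rule isCont_inverse_function2[OF at(2), of "t + 1"])
      fix r assume "?a \<le> r" "r \<le> t + 1"
      then show "?T (s r) = r" "isCont s r"
        using at by (auto intro!: t_of_s DERIV_isCont[OF s_deriv])
    qed simp
  qed (use lt sT in auto)
  then have "((g \<circ> ?T) has_vector_derivative inverse (w t) *\<^sub>R d) (at (s t))"
    using t g by (intro vector_diff_chain_at) (simp_all add: t_of_s has_real_derivative_iff_has_vector_derivative)
  then show "(h has_vector_derivative (1 / w t) *\<^sub>R d) (at (s t))"
    unfolding inverse_eq_divide
  proof (rule has_vector_derivative_transform_within_open[where S="{s ?a<..<s (t + 1)}"])
    fix r assume "r \<in> {s ?a<..<s (t + 1)}"
    then show "(g \<circ> ?T) r = h r" using sT h[of "?T r"] by simp
  qed (use lt in auto)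
qed

end

section \<open>The Lyapunov argument\<close>

text \<open>With the integrating factor \<open>exp (c * s t)\<close> the excess of \<open>F\<close>
  over the equilibrium \<open>e\<close> does not grow. Since \<open>s\<close> is unbounded, the
  initial excess eventually contributes less than another \<open>e\<close>.\<close>

lemma gronwall_eventually_le:
  fixes F s w :: "real \<Rightarrow> real"
  assumes F: "\<And>t. T \<le> t \<Longrightarrow> (F has_real_derivative F' t) (at t)"
    and s: "\<And>t. T \<le> t \<Longrightarrow> (s has_real_derivative w t) (at t)"
    and le: "\<And>t. T \<le> t \<Longrightarrow> F' t \<le> w t * (c * e - c * F t)"
    and c: "0 < c" and e: "0 < e"
    and s_lim: "filterlim s at_top at_top"
  shows "\<forall>\<^sub>F t in at_top. F t \<le> 2 * e"
proof -
  define H where "H t = exp (c * s t) * (F t - e)" for t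
  have H: "H t \<le> H T" if "T \<le> t" for t
  proof (rule DERIV_nonpos_imp_nonincreasing[OF that])
    fix r assume "T \<le> r" "r \<le> t"
    then have "(H has_real_derivative exp (c * s r) * (F' r - w r * (c * e - c * F r))) (at r)"
      unfolding H_def by (auto intro!: derivative_eq_intros F s simp: algebra_simps)
    moreover have "exp (c * s r) * (F' r - w r * (c * e - c * F r)) \<le> 0"
      using le[OF \<open>T \<le> r\<close>] by (simp add: mult_le_0_iff)
    ultimately show "\<exists>d. DERIV H r :> d \<and> d \<le> 0" by blast
  qed
  have "((\<lambda>t. H T * exp (- (c * s t))) \<longlongrightarrow> H T * 0) at_top"
    by (intro tendsto_mult_left filterlim_compose[OF exp_at_bot]
        filterlim_compose[OF filterlim_uminus_at_bot_at_top]
        filterlim_tendsto_pos_mult_at_top[OF tendsto_const c s_lim])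
  then have "\<forall>\<^sub>F t in at_top. H T * exp (- (c * s t)) < e"
    using e by (intro order_tendstoD(2)) auto
  moreover have "\<forall>\<^sub>F t in at_top. T \<le> t" by (rule eventually_ge_at_top)
  ultimately show ?thesis
  proof eventually_elim
    case (elim t)
    have "F t - e = H t * exp (- (c * s t))" by (simp add: H_def exp_minus field_simps)
    also have "\<dots> \<le> H T * exp (- (c * s t))" using H elim by (intro mult_right_mono) auto
    finally show ?case using elim by simp
  qed
qed

text \<open>The difference of the two sides is the sum of the squares of all pairwise
  differences.\<close>

lemma power2_sum5_le:
  fixes a b c d e :: real
  shows "(a + b + c + d + e)\<^sup>2 \<le> 5 * (a\<^sup>2 + b\<^sup>2 + c\<^sup>2 + d\<^sup>2 + e\<^sup>2)"
proof -
  have "0 \<le> (a-b)\<^sup>2 + (a-c)\<^sup>2 + (a-d)\<^sup>2 + (a-e)\<^sup>2 + (b-c)\<^sup>2 + (b-d)\<^sup>2 + (b-e)\<^sup>2 + (c-d)\<^sup>2 + (c-e)\<^sup>2 + (d-e)\<^sup>2"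
    by simp
  then show ?thesis by (simp add: power2_eq_square algebra_simps)
qed

text \<open>
  The system is written in the rescaled time but still parametrised by \<open>t\<close>: each rescaled derivative
  appears multiplied by \<open>w t = sqrt (\<epsilon> t)\<close>. Here \<open>u\<close> is the rescaled velocity, \<open>\<kappa> = \<sigma> / \<gamma>\<close>,
  \<open>\<nu>\<close> is the multiplier error, \<open>q\<close> is the rescaled derivative of \<open>p\<close>, and \<open>\<phi>\<close> is the Lagrangian at the
  optimal multiplier, shifted to have minimum \<open>0\<close>.
\<close>

locale rescaled_flow =
  fixes A :: "'a::euclidean_space \<Rightarrow> 'b::euclidean_space"
    and \<phi> :: "'a \<Rightarrow> real" and G :: "'a \<Rightarrow> 'a" and xs :: 'a
    and L \<rho> \<delta> \<kappa> \<gamma> \<eta>1 \<eta>2 T :: real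
    and w a p q \<beta> s :: "real \<Rightarrow> real"
    and x u :: "real \<Rightarrow> 'a" and \<nu> :: "real \<Rightarrow> 'b"
  assumes A: "linear A"
    and phi_convex: "convex_on UNIV \<phi>"
    and phi_grad: "\<And>y. GDERIV \<phi> y :> G y"
    and G_lipschitz: "L-lipschitz_on UNIV G" and L: "0 < L"
    and phi_nonneg: "\<And>y. 0 \<le> \<phi> y"
    and phi_xs: "\<phi> xs = 0"
    and min_norm: "\<And>y. \<phi> y = 0 \<Longrightarrow> A (y - xs) = 0 \<Longrightarrow> 0 \<le> xs \<bullet> (y - xs)"
    and params: "0 < \<rho>" "0 < \<kappa>" "0 < \<gamma>" "0 < \<eta>1" "0 < \<eta>2"
    and x_deriv: "\<And>t. T \<le> t \<Longrightarrow> (x has_vector_derivative w t *\<^sub>R u t) (at t)"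
    and u_deriv: "\<And>t. T \<le> t \<Longrightarrow> (u has_vector_derivative
          - w t *\<^sub>R ((\<delta> - p t / 2) *\<^sub>R u t
            + a t *\<^sub>R (G (x t + (\<beta> t * w t) *\<^sub>R u t)
                + \<rho> *\<^sub>R adjoint A (A (x t + (\<beta> t * w t) *\<^sub>R u t - xs)) + adjoint A (\<nu> t))
            + x t)) (at t)"
    and nu_deriv: "\<And>t. T \<le> t \<Longrightarrow>
          (\<nu> has_vector_derivative (w t * \<gamma> * a t) *\<^sub>R A (x t - xs + (1 / \<kappa>) *\<^sub>R u t)) (at t)"
    and a_deriv: "\<And>t. T \<le> t \<Longrightarrow> (a has_real_derivative w t * (p t * a t)) (at t)"
    and p_deriv: "\<And>t. T \<le> t \<Longrightarrow> (p has_real_derivative w t * q t) (at t)"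
    and s_deriv: "\<And>t. T \<le> t \<Longrightarrow> (s has_real_derivative w t) (at t)"
    and w_pos: "\<And>t. T \<le> t \<Longrightarrow> 0 < w t"
    and a_w: "\<And>t. T \<le> t \<Longrightarrow> a t * (w t)\<^sup>2 = 1"
    and w_lim: "(w \<longlongrightarrow> 0) at_top"
    and s_lim: "filterlim s at_top at_top"
    and beta_nonneg: "\<And>t. T \<le> t \<Longrightarrow> 0 \<le> \<beta> t"
    and beta_bounded: "bounded (\<beta> ` {T..})"
    and p_nonneg: "\<And>t. T \<le> t \<Longrightarrow> 0 \<le> p t"
    and p_le: "\<And>t. T \<le> t \<Longrightarrow> \<eta>1 \<le> \<kappa> - p t"
    and damping: "\<And>t. T \<le> t \<Longrightarrow> \<eta>2 \<le> \<delta> - \<kappa> - p t / 2 - \<kappa> * L / 2 * (\<beta> t)\<^sup>2"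
    and q_ge: "\<And>t. T \<le> t \<Longrightarrow> \<kappa> / 4 * (- q t) \<le> (\<kappa> + p t) / 8"
    and nu_range: "\<And>t. T \<le> t \<Longrightarrow> \<nu> t \<in> range A"
begin

text \<open>
  \<open>E\<close> is the energy in the rescaled time. In its derivative the terms in \<open>\<nu>\<close> cancel (see \<open>dE_eq\<close>),
  so \<open>E\<close> alone does not control the multiplier. The cross term \<open>W\<close> repairs this: differentiating \<open>v\<close> produces
  \<open>- a t *\<^sub>R adjoint A (\<nu> t)\<close>, hence \<open>dW\<close> contains \<open>- (norm (adjoint A (\<nu> t)))\<^sup>2\<close>.
\<close>

definition "\<xi> t = x t - xs"
definition "v t = \<kappa> *\<^sub>R \<xi> t + u t"
definition "c t = \<beta> t * w t"
definition "z t = x t + c t *\<^sub>R u t"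
definition "D t = \<delta> - \<kappa> - p t / 2"
definition "g y = \<phi> y + \<rho> / 2 * (A (y - xs) \<bullet> A (y - xs))"
definition "r t = G (z t) + \<rho> *\<^sub>R adjoint A (A (z t - xs)) + adjoint A (\<nu> t)"
definition "E t = a t * g (x t) + (x t \<bullet> x t - xs \<bullet> xs) / 2 + (v t \<bullet> v t) / 2
    + \<kappa> / (2 * \<gamma>) * (\<nu> t \<bullet> \<nu> t) + \<kappa> * D t / 2 * (\<xi> t \<bullet> \<xi> t)"
definition "W t = (A (v t) \<bullet> \<nu> t) / a t"
definition "dE t = p t * a t * g (x t) + a t * (u t \<bullet> G (x t) + \<rho> * (A (\<xi> t) \<bullet> A (u t))) + x t \<bullet> u t
    - v t \<bullet> (D t *\<^sub>R u t + a t *\<^sub>R r t + x t) + a t * (\<nu> t \<bullet> A (v t))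
    + \<kappa> * D t * (\<xi> t \<bullet> u t) - \<kappa> * q t / 4 * (\<xi> t \<bullet> \<xi> t)"
definition "dW t = \<gamma> / \<kappa> * (A (v t) \<bullet> A (v t))
    - ((D t *\<^sub>R u t + a t *\<^sub>R r t + x t) \<bullet> adjoint A (\<nu> t) + p t * (A (v t) \<bullet> \<nu> t)) / a t"
definition "M = onorm A + onorm (adjoint A)"

section \<open>Derivatives of the energy and of the cross term\<close>

lemma A_adjoint: "y \<bullet> adjoint A y' = A y \<bullet> y'"
  by (rule adjoint_works[OF A])

lemma A_bounded: "bounded_linear A" "bounded_linear (adjoint A)"
  using A adjoint_linear[OF A] by (simp_all add: linear_conv_bounded_linear)

lemma norm_A_le: "norm (A y) \<le> M * norm y" "norm (adjoint A y') \<le> M * norm y'"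
  using onorm[OF A_bounded(1), of y] onorm[OF A_bounded(2), of y']
    onorm_pos_le[OF A_bounded(1)] onorm_pos_le[OF A_bounded(2)]
  by (simp_all add: M_def distrib_right add_increasing add_increasing2)

lemma M_nonneg: "0 \<le> M"
  using onorm_pos_le[OF A_bounded(1)] onorm_pos_le[OF A_bounded(2)] by (simp add: M_def)

lemma A_v: "A (\<xi> t + (1 / \<kappa>) *\<^sub>R u t) = (1 / \<kappa>) *\<^sub>R A (v t)"
  using params(2) by (simp add: v_def linear_add[OF A] linear_scale[OF A] scaleR_add_right)

lemma xi_deriv: "T \<le> t \<Longrightarrow> (\<xi> has_vector_derivative w t *\<^sub>R u t) (at t)"
  unfolding \<xi>_def[abs_def] by (auto intro!: derivative_eq_intros x_deriv)

text \<open>The velocity contributed by \<open>\<kappa> *\<^sub>R \<xi> t\<close> lowers the damping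
  coefficient from \<open>\<delta> - p t / 2\<close> to \<open>D t\<close>.\<close>

lemma v_deriv:
  assumes "T \<le> t"
  shows "(v has_vector_derivative - w t *\<^sub>R (D t *\<^sub>R u t + a t *\<^sub>R r t + x t)) (at t)"
proof -
  have "((\<lambda>t. \<kappa> *\<^sub>R \<xi> t) has_vector_derivative \<kappa> *\<^sub>R (w t *\<^sub>R u t)) (at t)"
    by (rule bounded_linear.has_vector_derivative[OF bounded_linear_scaleR_right xi_deriv[OF assms]])
  from has_vector_derivative_add[OF this u_deriv[OF assms]] show ?thesis
    unfolding v_def[abs_def] by (simp add: D_def r_def z_def c_def algebra_simps)
qed

lemma a_pos:
  assumes "T \<le> t"
  shows "0 < a t"
proof -
  have "0 < a t * (w t)\<^sup>2" using a_w[OF assms] by simp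
  then show ?thesis using w_pos[OF assms] by (simp add: zero_less_mult_iff)
qed

lemma nu_deriv': "T \<le> t \<Longrightarrow> (\<nu> has_vector_derivative (w t * \<gamma> * a t / \<kappa>) *\<^sub>R A (v t)) (at t)"
  using nu_deriv[of t] A_v[of t] by (simp add: \<xi>_def)

lemma E_deriv:
  assumes "T \<le> t"
  shows "(E has_real_derivative w t * dE t) (at t)"
proof -
  define P where "P = D t *\<^sub>R u t + a t *\<^sub>R r t + x t"
  note d = xi_deriv[OF assms] v_deriv[OF assms, folded P_def] x_deriv[OF assms] nu_deriv'[OF assms]
  have A\<xi>: "((\<lambda>t. A (x t - xs)) has_vector_derivative A (w t *\<^sub>R u t)) (at t)"
    using bounded_linear.has_vector_derivative[OF A_bounded(1) d(1)] by (simp add: \<xi>_def[abs_def])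
  have D: "(D has_real_derivative - w t * q t / 2) (at t)"
    unfolding D_def[abs_def] using DERIV_diff[OF DERIV_const[of "\<delta> - \<kappa>"] DERIV_cdivide[OF p_deriv[OF assms], of 2]]
    by simp
  note terms = DERIV_mult[OF a_deriv[OF assms] DERIV_add[OF
        GDERIV_compose_vector_derivative[where g=x, OF phi_grad x_deriv[OF assms]]
        DERIV_cmult[OF has_real_derivative_inner[OF A\<xi> A\<xi>], of "\<rho> / 2"]]]
    DERIV_cdivide[OF DERIV_diff[OF has_real_derivative_inner[OF d(3,3)] DERIV_const[of "xs \<bullet> xs"]], of 2]
    DERIV_cdivide[OF has_real_derivative_inner[OF d(2,2)], of 2]
    DERIV_cmult[OF has_real_derivative_inner[OF d(4,4)], of "\<kappa> / (2 * \<gamma>)"]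
    DERIV_mult[OF DERIV_cdivide[OF DERIV_cmult[OF D, of \<kappa>], of 2] has_real_derivative_inner[OF d(1,1)]]
  show ?thesis
    unfolding E_def[abs_def] g_def[abs_def]
    by (rule DERIV_cong[OF DERIV_add[OF DERIV_add[OF DERIV_add[OF DERIV_add[OF terms(1,2)] terms(3)] terms(4)] terms(5)]])
      (use params in \<open>simp add: dE_def[of t, folded P_def] g_def \<xi>_def linear_scale[OF A] inner_commute field_simps\<close>)
qed

lemma W_deriv:
  assumes "T \<le> t"
  shows "(W has_real_derivative w t * dW t) (at t)"
proof -
  define P where "P = D t *\<^sub>R u t + a t *\<^sub>R r t + x t"
  note d = v_deriv[OF assms, folded P_def] nu_deriv'[OF assms]
  have "((\<lambda>t. A (v t)) has_vector_derivative A (- w t *\<^sub>R P)) (at t)"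
    by (rule bounded_linear.has_vector_derivative[OF A_bounded(1) d(1)])
  then have Av: "((\<lambda>t. A (v t)) has_vector_derivative - w t *\<^sub>R A P) (at t)"
    by (simp only: linear_scale[OF A])
  show ?thesis
    unfolding W_def[abs_def]
    by (rule DERIV_cong[OF DERIV_divide[OF has_real_derivative_inner[OF Av d(2)] a_deriv[OF assms]]])
      (use params a_pos[OF assms] in
        \<open>simp_all add: dW_def[of t, folded P_def] A_adjoint inner_commute[of _ "\<nu> t"] field_simps\<close>)
qed

section \<open>Dissipation of the energy\<close>

lemma g_nonneg: "0 \<le> g y"
  using phi_nonneg[of y] params(1) by (simp add: g_def)

lemma p_less: "T \<le> t \<Longrightarrow> p t < \<kappa>"
  using p_le[of t] params(4) by linarith

lemma D_bounds:
  assumes "T \<le> t"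
  shows "0 \<le> D t" "D t \<le> \<delta>" "\<eta>2 + \<kappa> * L / 2 * (\<beta> t)\<^sup>2 \<le> D t"
proof -
  have "0 \<le> \<kappa> * L / 2 * (\<beta> t)\<^sup>2" using params(2) L by simp
  then show "0 \<le> D t" "\<eta>2 + \<kappa> * L / 2 * (\<beta> t)\<^sup>2 \<le> D t" "D t \<le> \<delta>"
    using damping[OF assms] params p_nonneg[OF assms] by (auto simp: D_def)
qed

lemma c_nonneg: "T \<le> t \<Longrightarrow> 0 \<le> c t"
  using beta_nonneg w_pos by (simp add: c_def less_imp_le)

text \<open>The extrapolation length \<open>c\<close> carries a factor \<open>w\<close>, so its
  square cancels the growing weight \<open>a\<close> exactly. The gradient error therefore costs
  only a multiple of the square of \<open>\<beta>\<close>, which \<open>damping\<close> pays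
  for.\<close>

lemma a_c: "T \<le> t \<Longrightarrow> a t * (c t)\<^sup>2 = (\<beta> t)\<^sup>2"
  using a_w[of t] by (simp add: c_def power_mult_distrib mult.left_commute)

text \<open>Convexity compares \<open>z'\<close> with the minimiser and the quadratic upper bound
  compares \<open>y\<close> with \<open>z'\<close>. The quadratic loss is the price of evaluating
  the gradient at the extrapolated point instead of at \<open>y\<close>.\<close>

lemma gradient_three_point: "\<phi> y - L / 2 * (norm (z' - y))\<^sup>2 \<le> G z' \<bullet> (y - xs)"
proof -
  have "\<phi> z' + G z' \<bullet> (xs - z') \<le> 0"
    using convex_gradient_le[OF phi_convex phi_grad, of z' xs] phi_xs by simp
  moreover have "\<phi> y \<le> \<phi> z' + G z' \<bullet> (y - z') + L / 2 * (norm (y - z'))\<^sup>2"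
    by (rule lipschitz_gradient_upper_bound[OF phi_grad G_lipschitz])
  ultimately show ?thesis by (simp add: norm_minus_commute inner_diff_right)
qed

lemma gradient_monotone: "0 \<le> (G y - G y') \<bullet> (y - y')"
  using convex_gradient_le[OF phi_convex phi_grad, of y y'] convex_gradient_le[OF phi_convex phi_grad, of y' y]
  by (simp add: inner_diff_right inner_diff_left)

text \<open>Besides the terms in \<open>\<nu>\<close>, the products
  \<open>x t \<bullet> u t\<close>, \<open>\<xi> t \<bullet> u t\<close> and the unweighted
  \<open>A (\<xi> t) \<bullet> A (u t)\<close> cancel; the coefficients in \<open>E\<close> are
  chosen to this end.\<close>

lemma dE_eq:
  "dE t = p t * a t * g (x t) + a t * (u t \<bullet> G (x t) - u t \<bullet> G (z t)) - a t * \<kappa> * (G (z t) \<bullet> \<xi> t)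
    - D t * (u t \<bullet> u t) - \<kappa> * (\<xi> t \<bullet> x t) - \<kappa> * q t / 4 * (\<xi> t \<bullet> \<xi> t)
    - a t * \<rho> * (\<kappa> * (A (\<xi> t) \<bullet> A (\<xi> t)) + \<kappa> * c t * (A (\<xi> t) \<bullet> A (u t)) + c t * (A (u t) \<bullet> A (u t)))"
proof -
  have 1: "A (z t - xs) = A (\<xi> t) + c t *\<^sub>R A (u t)"
    by (simp add: z_def \<xi>_def linear_add[OF A] linear_diff[OF A] linear_scale[OF A])
  have 2: "A (v t) = \<kappa> *\<^sub>R A (\<xi> t) + A (u t)"
    by (simp add: v_def linear_add[OF A] linear_scale[OF A])
  show ?thesis
    by (simp add: dE_def r_def 1 2 inner_add_left inner_add_right A_adjoint v_def linear_add[OF A] linear_scale[OF A])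
      (simp add: inner_commute algebra_simps)
qed

lemma dE_le:
  assumes t: "T \<le> t" and c: "\<kappa> * c t \<le> 2"
  shows "dE t \<le> - \<eta>1 * a t * g (x t) - \<eta>2 * (u t \<bullet> u t) - 3 / 4 * \<kappa> * (\<xi> t \<bullet> \<xi> t) - \<kappa> * (xs \<bullet> \<xi> t)"
proof -
  note [simp] = a_pos[OF t, THEN less_imp_le]
  define h k where "h = A (\<xi> t)" and "k = A (u t)"
  \<comment> \<open>The points \<open>z t\<close> and \<open>x t\<close> differ by
    \<open>c t *\<^sub>R u t\<close>, so gradient monotonicity gives the sign after division by
    \<open>c t\<close>; if \<open>c t = 0\<close> they coincide.\<close>
  have mono: "a t * (u t \<bullet> G (x t) - u t \<bullet> G (z t)) \<le> 0"
  proof (cases "c t = 0")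
    case False
    then have "0 < c t" using c_nonneg[OF t] by simp
    moreover have "0 \<le> (G (z t) - G (x t)) \<bullet> (c t *\<^sub>R u t)"
      using gradient_monotone[of "z t" "x t"] by (simp add: z_def)
    ultimately have "0 \<le> (G (z t) - G (x t)) \<bullet> u t" by (simp add: zero_le_mult_iff)
    then have "u t \<bullet> G (x t) - u t \<bullet> G (z t) \<le> 0" by (simp add: inner_diff_left inner_commute[of "u t"])
    then show ?thesis by (simp add: mult_le_0_iff)
  qed (simp add: z_def)
  have three: "- a t * \<kappa> * (G (z t) \<bullet> \<xi> t) \<le> - a t * \<kappa> * \<phi> (x t) + \<kappa> * L / 2 * (\<beta> t)\<^sup>2 * (u t \<bullet> u t)"
  proof -
    have "\<phi> (x t) - L / 2 * ((c t)\<^sup>2 * (u t \<bullet> u t)) \<le> G (z t) \<bullet> \<xi> t"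
      using gradient_three_point[of "x t" "z t"]
      by (simp add: z_def \<xi>_def power_mult_distrib dot_square_norm)
    from mult_left_mono[OF this, of "a t * \<kappa>"]
    have "a t * \<kappa> * \<phi> (x t) - \<kappa> * L / 2 * (a t * (c t)\<^sup>2) * (u t \<bullet> u t) \<le> a t * \<kappa> * (G (z t) \<bullet> \<xi> t)"
      using params(2) by (simp add: algebra_simps)
    then show ?thesis unfolding a_c[OF t] by simp
  qed
  \<comment> \<open>Completing the square in \<open>k\<close> costs
    \<open>c t * \<kappa>\<^sup>2 / 4\<close> times \<open>h \<bullet> h\<close>, and
    \<open>\<kappa> * c t \<le> 2\<close> makes this at most half of the available constraint
    term.\<close>
  have young: "- (\<kappa> * (h \<bullet> h) + \<kappa> * c t * (h \<bullet> k) + c t * (k \<bullet> k)) \<le> - (\<kappa> / 2) * (h \<bullet> h)"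
  proof -
    have "0 \<le> c t * ((k + (\<kappa> / 2) *\<^sub>R h) \<bullet> (k + (\<kappa> / 2) *\<^sub>R h))"
      using c_nonneg[OF t] by simp
    moreover have "(\<kappa> * c t) * (\<kappa> * (h \<bullet> h)) \<le> 2 * (\<kappa> * (h \<bullet> h))"
      using c params(2) by (intro mult_right_mono) auto
    ultimately show ?thesis
      by (simp add: inner_add_left inner_add_right inner_commute algebra_simps)
  qed
  \<comment> \<open>The half that survives has precisely the weight \<open>\<rho> / 2\<close> of the
    penalty in \<open>g\<close>, so the last two terms form
    \<open>- a t * \<kappa> * g (x t)\<close>.\<close>
  have pg: "p t * a t * g (x t) - a t * \<kappa> * \<phi> (x t) + a t * \<rho> * (- (\<kappa> / 2) * (h \<bullet> h)) \<le> - \<eta>1 * a t * g (x t)"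
  proof -
    have "\<eta>1 * (a t * g (x t)) \<le> (\<kappa> - p t) * (a t * g (x t))"
      using p_le[OF t] by (intro mult_right_mono) (simp_all add: g_nonneg)
    then show ?thesis by (simp add: g_def h_def \<xi>_def algebra_simps add_divide_distrib diff_divide_distrib)
  qed
  have "D t * (u t \<bullet> u t) \<ge> (\<eta>2 + \<kappa> * L / 2 * (\<beta> t)\<^sup>2) * (u t \<bullet> u t)"
    using D_bounds(3)[OF t] by (rule mult_right_mono) simp
  moreover have "- \<kappa> * q t / 4 * (\<xi> t \<bullet> \<xi> t) \<le> \<kappa> / 4 * (\<xi> t \<bullet> \<xi> t)"
    using q_ge[OF t] p_less[OF t] by (intro mult_right_mono) auto
  moreover have "\<xi> t \<bullet> x t = \<xi> t \<bullet> \<xi> t + xs \<bullet> \<xi> t"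
    by (simp add: \<xi>_def inner_diff_right inner_diff_left inner_commute)
  moreover have "a t * \<rho> * (- (\<kappa> * (h \<bullet> h) + \<kappa> * c t * (h \<bullet> k) + c t * (k \<bullet> k))) \<le> a t * \<rho> * (- (\<kappa> / 2) * (h \<bullet> h))"
    using params(1) by (intro mult_left_mono[OF young]) simp
  ultimately show ?thesis
    using mono three pg unfolding dE_eq h_def[symmetric] k_def[symmetric]
    by (simp add: algebra_simps)
qed

section \<open>Derivative of the cross term\<close>

definition "R1 = L + \<rho> * M\<^sup>2 + \<delta> + \<kappa>"
text \<open>The sum of the five coefficients met in estimating \<open>dW\<close>, so that it
  dominates each. The factor \<open>5 / 2\<close> joins the Young half to the five-term square;
  \<open>2 / \<rho>\<close> undoes the weight of the constraint violation in \<open>g\<close>;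
  \<open>R1\<close> collects everything that multiplies the velocity norm.\<close>

definition "K = 5 * L + 2 / \<rho> * (5 / 2 * \<rho>\<^sup>2 * M\<^sup>2 + 2 * \<gamma> * \<kappa>) + (5 / 2 * R1\<^sup>2 + 2 * \<gamma> / \<kappa> * M\<^sup>2)
  + 5 / 2 * (1 + \<kappa>\<^sup>2)\<^sup>2 + 5 / 2 * (norm xs)\<^sup>2"

text \<open>After division by \<open>a\<close> the force from \<open>\<nu>\<close> has unit weight
  and yields the negative square. Every other force, gathered in \<open>R\<close>, is controlled by
  the gap, the velocity, or a term carrying \<open>1 / a\<close>;
  \<open>gradient_norm_le_gap\<close> is what turns the gradient into the gap.\<close>

lemma dW_le:
  assumes t: "T \<le> t" and c: "c t \<le> 1" and a: "1 \<le> a t"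
  shows "dW t \<le> - (adjoint A (\<nu> t) \<bullet> adjoint A (\<nu> t)) / 2
    + K * (g (x t) + u t \<bullet> u t + (\<xi> t \<bullet> \<xi> t + 1) / a t)"
proof -
  define Y where "Y = 1 / a t"
  have Y: "0 < Y" "Y \<le> 1" "Y\<^sup>2 \<le> Y" using a by (auto simp: Y_def field_simps power2_eq_square)
  define n where "n = adjoint A (\<nu> t)"
  define R where "R = G (z t) + \<rho> *\<^sub>R adjoint A (A (z t - xs)) + Y *\<^sub>R (D t *\<^sub>R u t + x t + p t *\<^sub>R v t)"
  define G' H U X where "G' = norm (G (x t))" and "H = norm (A (\<xi> t))" and "U = norm (u t)" and "X = norm (\<xi> t)"
  have c0: "0 \<le> c t" using c_nonneg[OF t] .
  have Az: "A (z t - xs) = A (\<xi> t) + c t *\<^sub>R A (u t)"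
    by (simp add: z_def \<xi>_def linear_add[OF A] linear_diff[OF A] linear_scale[OF A])
  have "dW t = \<gamma> / \<kappa> * (A (v t) \<bullet> A (v t)) - n \<bullet> n - n \<bullet> R"
  proof -
    have R: "R = r t - n + Y *\<^sub>R (D t *\<^sub>R u t + x t + p t *\<^sub>R v t)"
      by (simp add: R_def r_def n_def)
    have "A (v t) \<bullet> \<nu> t = v t \<bullet> n" by (simp add: n_def A_adjoint)
    then show ?thesis
      unfolding dW_def n_def[symmetric] R using a
      by (simp add: Y_def inner_add_left inner_add_right inner_diff_right
          inner_commute[of n "u t"] inner_commute[of n "x t"] inner_commute[of n "v t"]
          inner_commute[of n "r t"] field_simps)
  qed
  \<comment> \<open>Half of the multiplier dissipation is sacrificed to absorb the mixed product
    with \<open>R\<close>.\<close>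
  moreover have "- (n \<bullet> n) - n \<bullet> R \<le> - (n \<bullet> n) / 2 + (norm R)\<^sup>2 / 2"
    using inner_ge_zero[of "n + R"]
    by (simp add: inner_add_left inner_add_right inner_commute dot_square_norm[symmetric])
  moreover have "(norm R)\<^sup>2 \<le> 5 * (2 * L * \<phi> (x t) + \<rho>\<^sup>2 * M\<^sup>2 * H\<^sup>2 + R1\<^sup>2 * U\<^sup>2
      + Y * ((1 + \<kappa>\<^sup>2)\<^sup>2 * X\<^sup>2) + Y * (norm xs)\<^sup>2)"
  proof -
    have "norm (G (z t)) \<le> G' + L * U"
    proof -
      have "norm (G (z t) - G (x t)) \<le> L * (c t * U)"
        using lipschitz_onD[OF G_lipschitz, of "z t" "x t"] c0 by (simp add: dist_norm z_def U_def)
      also have "\<dots> \<le> L * U" using c c0 L by (intro mult_left_mono mult_left_le_one_le) (auto simp: U_def)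
      finally show ?thesis using norm_triangle_sub[of "G (z t)" "G (x t)"] by (simp add: G'_def)
    qed
    moreover have "norm (\<rho> *\<^sub>R adjoint A (A (z t - xs))) \<le> \<rho> * M * H + \<rho> * M\<^sup>2 * U"
    proof -
      have "norm (A (z t - xs)) \<le> H + M * U"
      proof -
        have "norm (A (z t - xs)) \<le> H + c t * norm (A (u t))"
          unfolding Az H_def using c0 norm_triangle_ineq[of "A (\<xi> t)" "c t *\<^sub>R A (u t)"] by simp
        also have "c t * norm (A (u t)) \<le> norm (A (u t))" using c c0 by (intro mult_left_le_one_le) auto
        also have "norm (A (u t)) \<le> M * U" unfolding U_def by (rule norm_A_le)
        finally show ?thesis by simp
      qed
      then have "\<rho> * (M * norm (A (z t - xs))) \<le> \<rho> * (M * (H + M * U))"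
        using params(1) M_nonneg by (intro mult_left_mono) auto
      moreover have "\<rho> * norm (adjoint A (A (z t - xs))) \<le> \<rho> * (M * norm (A (z t - xs)))"
        using params(1) by (intro mult_left_mono norm_A_le) auto
      ultimately have "\<rho> * norm (adjoint A (A (z t - xs))) \<le> \<rho> * (M * (H + M * U))" by linarith
      then show ?thesis using params(1) by (simp add: distrib_left power2_eq_square mult.assoc)
    qed
    moreover have "norm (Y *\<^sub>R (D t *\<^sub>R u t + x t + p t *\<^sub>R v t)) \<le> (\<delta> + \<kappa>) * U + Y * (1 + \<kappa>\<^sup>2) * X + Y * norm xs"
    proof -
      have "norm (x t) \<le> X + norm xs" using norm_triangle_ineq[of "\<xi> t" xs] by (simp add: \<xi>_def X_def)
      moreover have "norm (D t *\<^sub>R u t) \<le> \<delta> * U"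
        using D_bounds[OF t] by (auto simp: U_def intro: mult_right_mono)
      moreover have "norm (p t *\<^sub>R v t) \<le> \<kappa> * (\<kappa> * X + U)"
      proof -
        have "norm (v t) \<le> \<kappa> * X + U"
          using norm_triangle_ineq[of "\<kappa> *\<^sub>R \<xi> t" "u t"] params(2) by (simp add: v_def X_def U_def)
        then show ?thesis
          using p_nonneg[OF t] p_less[OF t] params(2) by (auto intro!: mult_mono)
      qed
      ultimately have "norm (D t *\<^sub>R u t + x t + p t *\<^sub>R v t) \<le> \<delta> * U + (X + norm xs) + \<kappa> * (\<kappa> * X + U)"
        by (intro order_trans[OF norm_triangle_ineq] add_mono order_trans[OF norm_triangle_ineq]) auto
      then have "norm (Y *\<^sub>R (D t *\<^sub>R u t + x t + p t *\<^sub>R v t)) \<le> Y * (\<delta> * U + (X + norm xs) + \<kappa> * (\<kappa> * X + U))"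
        using Y by (simp add: mult_left_mono)
      also have "\<dots> = Y * ((\<delta> + \<kappa>) * U) + Y * (1 + \<kappa>\<^sup>2) * X + Y * norm xs"
        by (simp add: algebra_simps power2_eq_square)
      also have "Y * ((\<delta> + \<kappa>) * U) \<le> (\<delta> + \<kappa>) * U"
        using Y D_bounds[OF t] params(2) by (intro mult_left_le_one_le) (auto simp: U_def)
      finally show ?thesis by simp
    qed
    ultimately have "norm R \<le> G' + \<rho> * M * H + R1 * U + Y * (1 + \<kappa>\<^sup>2) * X + Y * norm xs"
      unfolding R_def R1_def
      by (intro order_trans[OF norm_triangle_ineq])
        (use norm_triangle_ineq[of "G (z t)" "\<rho> *\<^sub>R adjoint A (A (z t - xs))"] in \<open>simp add: algebra_simps\<close>)
    then have "(norm R)\<^sup>2 \<le> (G' + \<rho> * M * H + R1 * U + Y * (1 + \<kappa>\<^sup>2) * X + Y * norm xs)\<^sup>2"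
      by (intro power_mono) auto
    also have "\<dots> \<le> 5 * (G'\<^sup>2 + (\<rho> * M * H)\<^sup>2 + (R1 * U)\<^sup>2 + (Y * (1 + \<kappa>\<^sup>2) * X)\<^sup>2 + (Y * norm xs)\<^sup>2)"
      by (rule power2_sum5_le)
    also have "\<dots> \<le> 5 * (2 * L * \<phi> (x t) + \<rho>\<^sup>2 * M\<^sup>2 * H\<^sup>2 + R1\<^sup>2 * U\<^sup>2
        + Y * ((1 + \<kappa>\<^sup>2)\<^sup>2 * X\<^sup>2) + Y * (norm xs)\<^sup>2)"
    proof -
      have "G'\<^sup>2 \<le> 2 * L * \<phi> (x t)"
        unfolding G'_def by (rule gradient_norm_le_gap[OF phi_grad G_lipschitz L phi_nonneg])
      moreover have "Y\<^sup>2 * ((1 + \<kappa>\<^sup>2)\<^sup>2 * X\<^sup>2) \<le> Y * ((1 + \<kappa>\<^sup>2)\<^sup>2 * X\<^sup>2)" "Y\<^sup>2 * (norm xs)\<^sup>2 \<le> Y * (norm xs)\<^sup>2"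
        using Y by (auto intro: mult_right_mono)
      ultimately show ?thesis by (simp add: power_mult_distrib mult.assoc)
    qed
    finally show ?thesis .
  qed
  moreover have "\<gamma> / \<kappa> * (A (v t) \<bullet> A (v t)) \<le> 2 * \<gamma> * \<kappa> * H\<^sup>2 + 2 * \<gamma> / \<kappa> * M\<^sup>2 * U\<^sup>2"
  proof -
    have "norm (A (v t)) \<le> \<kappa> * H + M * U"
    proof -
      have "norm (A (v t)) \<le> norm (\<kappa> *\<^sub>R A (\<xi> t)) + norm (A (u t))"
        unfolding v_def linear_add[OF A] linear_scale[OF A] by (rule norm_triangle_ineq)
      then show ?thesis using params(2) norm_A_le(1)[of "u t"] by (simp add: H_def U_def)
    qed
    then have "A (v t) \<bullet> A (v t) \<le> (\<kappa> * H + M * U)\<^sup>2"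
      unfolding dot_square_norm by (intro power_mono) auto
    also have "\<dots> \<le> 2 * (\<kappa> * H)\<^sup>2 + 2 * (M * U)\<^sup>2"
      using zero_le_power2[of "\<kappa> * H - M * U"] by (simp add: power2_sum power2_diff)
    finally have "\<gamma> / \<kappa> * (A (v t) \<bullet> A (v t)) \<le> \<gamma> / \<kappa> * (2 * (\<kappa> * H)\<^sup>2 + 2 * (M * U)\<^sup>2)"
      using params by (intro mult_left_mono) auto
    also have "\<dots> = 2 * \<gamma> * \<kappa> * H\<^sup>2 + 2 * \<gamma> / \<kappa> * M\<^sup>2 * U\<^sup>2"
      using params by (simp add: power_mult_distrib field_simps power2_eq_square)
    finally show ?thesis .
  qed
  moreover have "5 * L * \<phi> (x t) + (5 / 2 * \<rho>\<^sup>2 * M\<^sup>2 + 2 * \<gamma> * \<kappa>) * H\<^sup>2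
      + (5 / 2 * R1\<^sup>2 + 2 * \<gamma> / \<kappa> * M\<^sup>2) * U\<^sup>2 + 5 / 2 * (1 + \<kappa>\<^sup>2)\<^sup>2 * (Y * X\<^sup>2) + 5 / 2 * (norm xs)\<^sup>2 * Y
      \<le> K * \<phi> (x t) + (K * (\<rho> / 2)) * H\<^sup>2 + K * U\<^sup>2 + K * (Y * X\<^sup>2) + K * Y"
  proof -
    define k1 k2 k3 k4 k5 where k: "k1 = 5 * L" "k2 = 5 / 2 * \<rho>\<^sup>2 * M\<^sup>2 + 2 * \<gamma> * \<kappa>"
      "k3 = 5 / 2 * R1\<^sup>2 + 2 * \<gamma> / \<kappa> * M\<^sup>2" "k4 = 5 / 2 * (1 + \<kappa>\<^sup>2)\<^sup>2" "k5 = 5 / 2 * (norm xs)\<^sup>2"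
    have pos: "0 \<le> k1" "0 \<le> k2" "0 \<le> k3" "0 \<le> k4" "0 \<le> k5"
      using L params by (simp_all add: k)
    have K: "K = k1 + 2 / \<rho> * k2 + k3 + k4 + k5" unfolding K_def k ..
    have "0 \<le> 2 / \<rho> * k2" using pos params(1) by simp
    then have "k1 \<le> K" "2 / \<rho> * k2 \<le> K" "k3 \<le> K" "k4 \<le> K" "k5 \<le> K"
      unfolding K using pos by linarith+
    moreover from this(2) have "k2 \<le> K * (\<rho> / 2)" using params(1) by (simp add: field_simps)
    ultimately show ?thesis unfolding k(1,2,3,4,5)[symmetric] using Y(1) phi_nonneg
      by (intro add_mono mult_right_mono) auto
  qed
  moreover have Y: "(y + 1) / a t = Y * y + Y" "(K + X\<^sup>2 * K) / a t = Y * (X\<^sup>2 * K) + Y * K" for y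
    by (simp_all add: Y_def add_divide_distrib)
  ultimately show ?thesis
    unfolding n_def[symmetric]
    by (simp add: g_def \<xi>_def[symmetric] dot_square_norm H_def[symmetric] U_def[symmetric] X_def[symmetric])
      (simp add: Y algebra_simps)
qed

section \<open>The Tikhonov gap and the decay of the full functional\<close>

lemma g_continuous: "continuous_on UNIV g"
proof -
  have "continuous_on UNIV \<phi>"
    using phi_grad has_derivative_continuous unfolding gderiv_def continuous_on_eq_continuous_at[OF open_UNIV] by blast
  moreover have "continuous_on UNIV (\<lambda>y. A (y - xs))"
    by (intro continuous_on_compose2[OF linear_continuous_on[OF A_bounded(1)], of UNIV] continuous_intros) auto
  ultimately show ?thesis unfolding g_def[abs_def] by (intro continuous_intros)
qed

text \<open>
  Since \<open>xs\<close> is only the minimal-norm minimiser, \<open>xs \<bullet> (y - xs)\<close> may be negative away from the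
  minimisers; there \<open>g\<close> is bounded below by compactness and the factor \<open>\<alpha>\<close> makes it dominate.
\<close>

lemma regularised_lower_bound:
  assumes pos: "0 < \<eta>" "0 < \<theta>" "0 < k" "0 < e"
  shows "\<exists>a0\<ge>0. \<forall>\<alpha>\<ge>a0. \<forall>y. - e \<le> \<eta> * \<alpha> * g y + \<theta> * ((y - xs) \<bullet> (y - xs)) + k * (xs \<bullet> (y - xs))"
proof -
  define N where "N = norm xs * (k * norm xs / \<theta>)"
  \<comment> \<open>Only here is help from \<open>g\<close> required: outside the ball the quadratic
    term beats the linear one by Cauchy-Schwarz, and off the half-space the linear term alone
    exceeds \<open>- e\<close>.\<close>
  define C where "C = cball xs (k * norm xs / \<theta>) \<inter> {y. xs \<bullet> (y - xs) \<le> - e / k}"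
  have "\<exists>m>0. \<forall>y\<in>C. m \<le> g y"
  proof (cases "C = {}")
    case False
    have "closed {y. xs \<bullet> (y - xs) \<le> - e / k}" by (intro closed_Collect_le continuous_intros)
    then have "compact C" unfolding C_def by (intro compact_Int_closed) auto
    then obtain y where y: "y \<in> C" "\<And>y'. y' \<in> C \<Longrightarrow> g y \<le> g y'"
      using continuous_attains_inf[OF _ False continuous_on_subset[OF g_continuous]] by auto
    have "g y \<noteq> 0"
    proof
      assume "g y = 0"
      moreover have "0 \<le> \<rho> / 2 * (A (y - xs) \<bullet> A (y - xs))" using params(1) by simp
      ultimately have "\<phi> y = 0" "A (y - xs) = 0"
        using phi_nonneg[of y] params(1) by (auto simp: g_def add_nonneg_eq_0_iff)
      then have "0 \<le> xs \<bullet> (y - xs)" by (rule min_norm)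
      moreover have "- e / k < 0" using pos by simp
      ultimately show False using y(1) by (auto simp: C_def)
    qed
    then show ?thesis using y(2) g_nonneg[of y] by (intro exI[of _ "g y"]) auto
  qed (auto intro: exI[of _ 1])
  then obtain m where m: "0 < m" "\<And>y. y \<in> C \<Longrightarrow> m \<le> g y" by blast
  have N: "0 \<le> N" using pos by (simp add: N_def)
  \<comment> \<open>On \<open>C\<close> the linear term is at least \<open>- k * N\<close> and
    \<open>g\<close> is at least \<open>m\<close>, which gives the threshold for
    \<open>\<alpha>\<close>.\<close>
  have "- e \<le> \<eta> * \<alpha> * g y + \<theta> * ((y - xs) \<bullet> (y - xs)) + k * (xs \<bullet> (y - xs))"
    if \<alpha>: "k * N / (\<eta> * m) \<le> \<alpha>" for \<alpha> y
  proof -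
    have "0 \<le> k * N / (\<eta> * m)" using pos m N by simp
    then have \<alpha>0: "0 \<le> \<alpha>" using \<alpha> by linarith
    have sq: "0 \<le> \<theta> * ((y - xs) \<bullet> (y - xs))" and g0: "0 \<le> \<eta> * \<alpha> * g y"
      using pos \<alpha>0 g_nonneg[of y] by simp_all
    have cs: "- (norm xs * norm (y - xs)) \<le> xs \<bullet> (y - xs)"
      using Cauchy_Schwarz_ineq2[of xs "y - xs"] by linarith
    consider "y \<in> C" | "k * norm xs / \<theta> < norm (y - xs)" | "- e / k < xs \<bullet> (y - xs)"
      by (force simp: C_def dist_norm norm_minus_commute)
    then show ?thesis
    proof cases
      case 1
      have "k * N \<le> \<alpha> * (\<eta> * m)" using \<alpha> pos m by (simp add: divide_le_eq)
      also have "\<dots> \<le> \<alpha> * (\<eta> * g y)" using \<alpha>0 pos m(2)[OF 1] by (intro mult_left_mono) auto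
      finally have "k * N \<le> \<eta> * \<alpha> * g y" by (simp add: algebra_simps)
      moreover have "norm xs * norm (y - xs) \<le> N"
        unfolding N_def using 1 by (intro mult_left_mono) (auto simp: C_def dist_norm norm_minus_commute)
      then have "k * (- N) \<le> k * (xs \<bullet> (y - xs))" using cs pos by (intro mult_left_mono) auto
      ultimately show ?thesis using sq pos by linarith
    next
      case 2
      then have "k * norm xs \<le> \<theta> * norm (y - xs)" using pos by (simp add: field_simps)
      then have "k * norm xs * norm (y - xs) \<le> \<theta> * norm (y - xs) * norm (y - xs)"
        by (rule mult_right_mono) simp
      moreover have "k * (- (norm xs * norm (y - xs))) \<le> k * (xs \<bullet> (y - xs))"
        using pos by (intro mult_left_mono[OF cs]) simp
      ultimately show ?thesis using g0 pos by (simp add: dot_square_norm power2_eq_square)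
    next
      case 3
      then have "- e < k * (xs \<bullet> (y - xs))" using pos by (simp add: field_simps)
      then show ?thesis using sq g0 by linarith
    qed
  qed
  moreover have "0 \<le> k * N / (\<eta> * m)" using pos m N by simp
  ultimately show ?thesis by blast
qed

lemma a_at_top: "filterlim a at_top at_top"
proof -
  have "filterlim (\<lambda>t. inverse ((w t)\<^sup>2)) at_top at_top"
  proof (rule filterlim_inverse_at_top)
    show "((\<lambda>t. (w t)\<^sup>2) \<longlongrightarrow> 0) at_top" using tendsto_power[OF w_lim, of 2] by simp
    show "\<forall>\<^sub>F t in at_top. 0 < (w t)\<^sup>2"
      using eventually_ge_at_top[of T] by eventually_elim (use w_pos in force)
  qed
  moreover have "\<forall>\<^sub>F t in at_top. inverse ((w t)\<^sup>2) = a t"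
    using eventually_ge_at_top[of T]
    by eventually_elim (use a_w in \<open>metis inverse_unique mult.commute\<close>)
  ultimately show ?thesis by (simp add: filterlim_cong[OF refl refl])
qed

lemma c_lim: "(c \<longlongrightarrow> 0) at_top"
proof -
  obtain B where B: "\<And>t. T \<le> t \<Longrightarrow> \<bar>\<beta> t\<bar> \<le> B"
    using beta_bounded by (auto simp: bounded_iff)
  show ?thesis
  proof (rule tendsto_0_le[OF w_lim])
    show "\<forall>\<^sub>F t in at_top. norm (c t) \<le> norm (w t) * B"
      using eventually_ge_at_top[of T]
    proof eventually_elim
      case (elim t)
      then show ?case using mult_right_mono[OF B[of t], of "\<bar>w t\<bar>"] by (simp add: c_def abs_mult mult.commute)
    qed
  qed
qed

text \<open>The factor \<open>1 / a\<close> makes the cross term cost at most half of the squares of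
  \<open>v\<close> and \<open>\<nu>\<close> in \<open>E\<close>, so adding it preserves
  coercivity.\<close>

lemma W_bound:
  assumes t: "T \<le> t" and \<tau>: "0 \<le> \<tau>" and a: "4 * \<tau> * M \<le> a t" "8 * \<tau> * M * \<gamma> / \<kappa> \<le> a t"
  shows "\<bar>\<tau> * W t\<bar> \<le> (v t \<bullet> v t) / 4 + \<kappa> / (4 * \<gamma>) * (\<nu> t \<bullet> \<nu> t)"
proof -
  define V N where "V = norm (v t)" and "N = norm (\<nu> t)"
  have VN: "V * N \<le> (V\<^sup>2 + N\<^sup>2) / 2" using sum_squares_bound[of V N] by simp
  have a0: "0 < a t" by (rule a_pos[OF t])
  have "\<bar>A (v t) \<bullet> \<nu> t\<bar> \<le> norm (A (v t)) * N" unfolding N_def by (rule Cauchy_Schwarz_ineq2)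
  also have "\<dots> \<le> M * V * N" using norm_A_le(1)[of "v t"] by (intro mult_right_mono) (auto simp: V_def N_def)
  finally have "\<bar>\<tau> * W t\<bar> \<le> \<tau> * (M * (V * N)) / a t"
    using a0 \<tau> by (simp add: W_def abs_mult divide_right_mono mult_left_mono mult.assoc)
  also have "\<dots> \<le> \<tau> * (M * ((V\<^sup>2 + N\<^sup>2) / 2)) / a t"
    using VN \<tau> M_nonneg a0 by (intro divide_right_mono mult_left_mono) auto
  also have "\<dots> = (\<tau> * M / (2 * a t)) * V\<^sup>2 + (\<tau> * M / (2 * a t)) * N\<^sup>2"
    by (simp add: algebra_simps add_divide_distrib)
  also have "\<dots> \<le> 1 / 4 * V\<^sup>2 + \<kappa> / (4 * \<gamma>) * N\<^sup>2"
  proof (intro add_mono mult_right_mono)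
    show "\<tau> * M / (2 * a t) \<le> 1 / 4" using a(1) a0 \<tau> M_nonneg by (simp add: field_simps)
    have "2 * (\<tau> * M * \<gamma>) \<le> \<kappa> * a t"
      using a(2) params(2) mult_nonneg_nonneg[OF mult_nonneg_nonneg[OF \<tau> M_nonneg] less_imp_le[OF params(3)]]
      by (simp add: pos_divide_le_eq mult_ac)
    then show "\<tau> * M / (2 * a t) \<le> \<kappa> / (4 * \<gamma>)" using a0 params
      by (simp add: field_simps)
  qed auto
  finally show ?thesis by (simp add: V_def N_def dot_square_norm)
qed

text \<open>The quantity shown to vanish is what \<open>E\<close> still controls after half of its
  \<open>\<nu>\<close> term has paid for \<open>W\<close> and a quarter of the squared state error
  has been kept back for the Tikhonov gap. The argument runs separately for each tolerance
  \<open>e\<close>, with a starting time depending on \<open>e\<close> but with the rate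
  \<open>\<omega>\<close> fixed.\<close>

lemma lyapunov_convergence:
  "((\<lambda>t. (\<xi> t \<bullet> \<xi> t) / 4 + \<kappa> / (4 * \<gamma>) * (\<nu> t \<bullet> \<nu> t)) \<longlongrightarrow> 0) at_top"
proof -
  obtain e0 where e0: "0 < e0" "\<And>y. y \<in> range A \<Longrightarrow> e0 * norm y \<le> norm (adjoint A y)"
    using linear_bounded_below_range_adjoint[OF A] by blast
  have K: "0 < K"
  proof -
    have "0 < 5 * L" "0 \<le> 2 / \<rho> * (5 / 2 * \<rho>\<^sup>2 * M\<^sup>2 + 2 * \<gamma> * \<kappa>)" "0 \<le> 5 / 2 * R1\<^sup>2 + 2 * \<gamma> / \<kappa> * M\<^sup>2"
      "0 \<le> 5 / 2 * (1 + \<kappa>\<^sup>2)\<^sup>2" "0 \<le> 5 / 2 * (norm xs)\<^sup>2"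
      using L params by simp_all
    then show ?thesis unfolding K_def by linarith
  qed
  \<comment> \<open>The errors of the cross term may consume half of the gap and kinetic dissipation
    and \<open>\<kappa> / 4\<close> of the \<open>3 / 4 * \<kappa>\<close> available for the state
    error.\<close>
  define \<tau> where "\<tau> = Min {\<eta>1 / 2, \<eta>2 / 2, \<kappa> / 4} / K"
  have \<tau>: "0 < \<tau>" "\<tau> * K \<le> \<eta>1 / 2" "\<tau> * K \<le> \<eta>2 / 2" "\<tau> * K \<le> \<kappa> / 4"
    using K params by (simp_all add: \<tau>_def)
  \<comment> \<open>The coefficient of \<open>\<xi> t \<bullet> \<xi> t\<close> in the upper bound
    for \<open>F\<close>: from the shifted squared norm of \<open>x\<close>, from three quarters of
    the squared norm of \<open>v\<close>, and from the \<open>D\<close> term.\<close>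
  define C where "C = 1 / 2 + 3 / 2 * \<kappa>\<^sup>2 + \<kappa> * \<bar>\<delta>\<bar> / 2"
  have C: "0 < C" unfolding C_def using params by (simp add: add_pos_nonneg)
  \<comment> \<open>The first four entries fit \<open>\<omega> * F\<close> term by term into the
    dissipation left over; the last keeps \<open>\<kappa> - \<omega>\<close> positive, the weight of
    the linear term in the Tikhonov bound.\<close>
  define \<omega> where "\<omega> = Min {\<eta>1 / 4, \<kappa> / (4 * C), \<eta>2 / 3, \<tau> / 2 * e0\<^sup>2 / (3 * \<kappa> / (4 * \<gamma>)), \<kappa> / 2}"
  have \<omega>: "0 < \<omega>" "\<omega> \<le> \<eta>1 / 4" "\<omega> \<le> \<kappa> / (4 * C)" "\<omega> \<le> \<eta>2 / 3"
      "\<omega> \<le> \<tau> / 2 * e0\<^sup>2 / (3 * \<kappa> / (4 * \<gamma>))" "\<omega> \<le> \<kappa> / 2"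
    using params C \<tau>(1) e0(1) unfolding \<omega>_def by simp_all
  have \<omega>': "\<omega> * C \<le> \<kappa> / 4" "\<omega> * (3 * \<kappa> / (4 * \<gamma>)) \<le> \<tau> / 2 * e0\<^sup>2"
    using \<omega>(3,5) C params by (simp_all add: field_simps)
  define F where "F t = E t + \<tau> * W t" for t
  define dF where "dF t = dE t + \<tau> * dW t" for t
  define Q where "Q t = (\<xi> t \<bullet> \<xi> t) / 4 + \<kappa> / (4 * \<gamma>) * (\<nu> t \<bullet> \<nu> t)" for t
  have F_deriv: "(F has_real_derivative w t * dF t) (at t)" if "T \<le> t" for t
    using DERIV_add[OF E_deriv[OF that] DERIV_cmult[OF W_deriv[OF that], of \<tau>]]
    by (simp add: F_def[abs_def] dF_def algebra_simps)
  \<comment> \<open>Gronwall contributes \<open>2 * e / \<omega>\<close>, and the coercivity bound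
    \<open>Q t - e \<le> F t\<close> the additional \<open>e\<close>.\<close>
  have main: "\<forall>\<^sub>F t in at_top. Q t \<le> (2 / \<omega> + 1) * e" if e: "0 < e" for e
  proof -
    \<comment> \<open>The gap enters twice: \<open>a1\<close> serves the decay estimate, where
      \<open>\<omega> * F\<close> reduces the linear coefficient to
      \<open>\<kappa> - \<omega>\<close>, and \<open>a2\<close> the lower bound of \<open>F\<close>,
      which need not be nonnegative.\<close>
    obtain a1 where a1: "\<And>\<alpha> y. a1 \<le> \<alpha> \<Longrightarrow>
        - (e / 2) \<le> \<eta>1 / 4 * \<alpha> * g y + \<kappa> / 4 * ((y - xs) \<bullet> (y - xs)) + (\<kappa> - \<omega>) * (xs \<bullet> (y - xs))"
      using regularised_lower_bound[of "\<eta>1 / 4" "\<kappa> / 4" "\<kappa> - \<omega>" "e / 2"] params \<omega>(1,6) e by auto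
    obtain a2 where a2: "\<And>\<alpha> y. a2 \<le> \<alpha> \<Longrightarrow>
        - e \<le> 1 * \<alpha> * g y + 1 / 4 * ((y - xs) \<bullet> (y - xs)) + 1 * (xs \<bullet> (y - xs))"
      using regularised_lower_bound[of 1 "1 / 4" 1 e] e by auto
    define a0 where "a0 = Max {a1, a2, 1, 4 * \<tau> * M, 8 * \<tau> * M * \<gamma> / \<kappa>, \<kappa> / 2 / e}"
    have a0: "a1 \<le> a0" "a2 \<le> a0" "1 \<le> a0" "4 * \<tau> * M \<le> a0" "8 * \<tau> * M * \<gamma> / \<kappa> \<le> a0" "\<kappa> / 2 / e \<le> a0"
      unfolding a0_def by (rule Max_ge; simp)+
    have "\<forall>\<^sub>F t in at_top. T \<le> t \<and> a0 \<le> a t \<and> c t < min 1 (2 / \<kappa>)"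
    proof (intro eventually_conj)
      show "\<forall>\<^sub>F t in at_top. a0 \<le> a t" using a_at_top unfolding filterlim_at_top by blast
      show "\<forall>\<^sub>F t in at_top. c t < min 1 (2 / \<kappa>)"
        using params(2) by (intro order_tendstoD(2)[OF c_lim]) simp
    qed (rule eventually_ge_at_top)
    then obtain T' where T': "\<And>t. T' \<le> t \<Longrightarrow> T \<le> t \<and> a0 \<le> a t \<and> c t < min 1 (2 / \<kappa>)"
      unfolding eventually_at_top_linorder by blast
    have F_bounds: "F t \<le> a t * g (x t) + C * (\<xi> t \<bullet> \<xi> t) + xs \<bullet> \<xi> t + 3 / 2 * (u t \<bullet> u t)
          + 3 * \<kappa> / (4 * \<gamma>) * (\<nu> t \<bullet> \<nu> t)"
        "Q t - e \<le> F t" if t: "T' \<le> t" for t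
    proof -
      have tT: "T \<le> t" and a: "a1 \<le> a t" "a2 \<le> a t" "1 \<le> a t" "4 * \<tau> * M \<le> a t" "8 * \<tau> * M * \<gamma> / \<kappa> \<le> a t"
        using T'[OF t] a0 by (simp_all only: min_less_iff_conj) linarith+
      have W: "\<bar>\<tau> * W t\<bar> \<le> (v t \<bullet> v t) / 4 + \<kappa> / (4 * \<gamma>) * (\<nu> t \<bullet> \<nu> t)"
        using W_bound[OF tT _ a(4,5)] \<tau>(1) by simp
      have xx: "(x t \<bullet> x t - xs \<bullet> xs) / 2 = (\<xi> t \<bullet> \<xi> t) / 2 + xs \<bullet> \<xi> t"
        by (simp add: \<xi>_def inner_diff_left inner_diff_right inner_commute field_simps)
      have v: "v t \<bullet> v t \<le> 2 * \<kappa>\<^sup>2 * (\<xi> t \<bullet> \<xi> t) + 2 * (u t \<bullet> u t)"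
        using inner_ge_zero[of "\<kappa> *\<^sub>R \<xi> t - u t"]
        by (simp add: v_def inner_add_left inner_add_right inner_diff_left inner_diff_right inner_commute
            power2_eq_square algebra_simps)
      have half: "\<kappa> / (2 * \<gamma>) * (\<nu> t \<bullet> \<nu> t) = 2 * (\<kappa> / (4 * \<gamma>) * (\<nu> t \<bullet> \<nu> t))" by simp
      have "\<kappa> * D t / 2 * (\<xi> t \<bullet> \<xi> t) \<le> \<kappa> * \<bar>\<delta>\<bar> / 2 * (\<xi> t \<bullet> \<xi> t)"
        using D_bounds[OF tT] params(2) by (intro mult_right_mono divide_right_mono mult_left_mono) auto
      then show "F t \<le> a t * g (x t) + C * (\<xi> t \<bullet> \<xi> t) + xs \<bullet> \<xi> t + 3 / 2 * (u t \<bullet> u t)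
          + 3 * \<kappa> / (4 * \<gamma>) * (\<nu> t \<bullet> \<nu> t)"
        using W v unfolding F_def E_def C_def xx half abs_le_iff by (simp add: algebra_simps)
      have "0 \<le> \<kappa> * D t / 2 * (\<xi> t \<bullet> \<xi> t)" using D_bounds[OF tT] params(2) by simp
      moreover have "0 \<le> v t \<bullet> v t" by simp
      moreover have "- e \<le> a t * g (x t) + (\<xi> t \<bullet> \<xi> t) / 4 + xs \<bullet> \<xi> t"
        using a2[OF a(2), of "x t"] by (simp add: \<xi>_def)
      ultimately show "Q t - e \<le> F t"
        using W unfolding F_def E_def Q_def xx half abs_le_iff by linarith
    qed
    have "\<forall>\<^sub>F t in at_top. F t \<le> 2 * (e / \<omega>)"
    proof (rule gronwall_eventually_le)
      fix t assume t: "T' \<le> t"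
      have tT: "T \<le> t" and a: "a1 \<le> a t" "1 \<le> a t" "\<kappa> / 2 / e \<le> a t" and c: "c t \<le> 1" "c t < 2 / \<kappa>"
        using T'[OF t] a0 by (simp_all only: min_less_iff_conj) linarith+
      show "(F has_real_derivative w t * dF t) (at t)" "(s has_real_derivative w t) (at t)"
        using F_deriv[OF tT] s_deriv[OF tT] .
      have "\<kappa> * c t \<le> 2" using c(2) params(2) by (simp add: field_simps)
      note dE = dE_le[OF tT this] and dW = mult_left_mono[OF dW_le[OF tT c(1) a(2)] less_imp_le[OF \<tau>(1)]]
      have 1: "\<tau> * K * g (x t) \<le> \<eta>1 / 2 * (a t * g (x t))"
      proof (rule mult_mono)
        show "g (x t) \<le> a t * g (x t)" using mult_right_mono[OF a(2) g_nonneg[of "x t"]] by simp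
      qed (use \<tau> params g_nonneg in auto)
      have 2: "\<tau> * K * (u t \<bullet> u t) \<le> \<eta>2 / 2 * (u t \<bullet> u t)"
        using \<tau>(3) by (rule mult_right_mono) simp
      have 3: "\<tau> * K * ((\<xi> t \<bullet> \<xi> t + 1) / a t) \<le> \<kappa> / 4 * (\<xi> t \<bullet> \<xi> t) + e / 2"
      proof -
        have "\<tau> * K * ((\<xi> t \<bullet> \<xi> t + 1) / a t) \<le> \<kappa> / 4 * ((\<xi> t \<bullet> \<xi> t + 1) / a t)"
          using \<tau>(4) a by (intro mult_right_mono) auto
        also have "\<dots> = \<kappa> / 4 * ((\<xi> t \<bullet> \<xi> t) / a t) + \<kappa> / 4 / a t" by (simp add: add_divide_distrib algebra_simps)
        also have "\<dots> \<le> \<kappa> / 4 * (\<xi> t \<bullet> \<xi> t) + e / 2"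
        proof (intro add_mono mult_left_mono)
          show "(\<xi> t \<bullet> \<xi> t) / a t \<le> \<xi> t \<bullet> \<xi> t"
            using a(2) mult_left_mono[OF a(2), of "\<xi> t \<bullet> \<xi> t"] by (simp add: divide_le_eq)
          show "\<kappa> / 4 / a t \<le> e / 2" using a(2,3) e by (simp add: field_simps)
        qed (use params in auto)
        finally show ?thesis .
      qed
      have 4: "\<omega> * (3 * \<kappa> / (4 * \<gamma>) * (\<nu> t \<bullet> \<nu> t)) \<le> \<tau> / 2 * (adjoint A (\<nu> t) \<bullet> adjoint A (\<nu> t))"
      proof -
        have "(e0 * norm (\<nu> t))\<^sup>2 \<le> (norm (adjoint A (\<nu> t)))\<^sup>2"
          using e0 nu_range[OF tT] by (intro power_mono) auto
        then have "\<tau> / 2 * (e0\<^sup>2 * (\<nu> t \<bullet> \<nu> t)) \<le> \<tau> / 2 * (adjoint A (\<nu> t) \<bullet> adjoint A (\<nu> t))"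
          using \<tau>(1) by (intro mult_left_mono) (auto simp: dot_square_norm power_mult_distrib)
        moreover have "\<omega> * (3 * \<kappa> / (4 * \<gamma>)) * (\<nu> t \<bullet> \<nu> t) \<le> \<tau> / 2 * e0\<^sup>2 * (\<nu> t \<bullet> \<nu> t)"
          using \<omega>'(2) by (rule mult_right_mono) simp
        ultimately show ?thesis by (simp only: mult.assoc)
      qed
      have 5: "\<omega> * (a t * g (x t)) \<le> \<eta>1 / 4 * (a t * g (x t))"
        using \<omega>(2) a g_nonneg by (intro mult_right_mono) auto
      have 6: "\<omega> * (C * (\<xi> t \<bullet> \<xi> t)) \<le> \<kappa> / 4 * (\<xi> t \<bullet> \<xi> t)"
        using mult_right_mono[OF \<omega>'(1), of "\<xi> t \<bullet> \<xi> t"] by (simp add: mult.assoc)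
      have 7: "\<omega> * (3 / 2 * (u t \<bullet> u t)) \<le> \<eta>2 / 2 * (u t \<bullet> u t)"
        using mult_right_mono[OF \<omega>(4), of "3 / 2 * (u t \<bullet> u t)"] by simp
      have 8: "- (e / 2) \<le> \<eta>1 / 4 * (a t * g (x t)) + \<kappa> / 4 * (\<xi> t \<bullet> \<xi> t) + \<kappa> * (xs \<bullet> \<xi> t) - \<omega> * (xs \<bullet> \<xi> t)"
        using a1[OF a(1), of "x t"] by (simp add: \<xi>_def algebra_simps)
      have 9: "\<omega> * F t \<le> \<omega> * (a t * g (x t)) + \<omega> * (C * (\<xi> t \<bullet> \<xi> t)) + \<omega> * (xs \<bullet> \<xi> t)
          + \<omega> * (3 / 2 * (u t \<bullet> u t)) + \<omega> * (3 * \<kappa> / (4 * \<gamma>) * (\<nu> t \<bullet> \<nu> t))"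
        using mult_left_mono[OF F_bounds(1)[OF t] less_imp_le[OF \<omega>(1)]] by (simp only: distrib_left)
      have 10: "dF t \<le> - \<eta>1 * (a t * g (x t)) - \<eta>2 * (u t \<bullet> u t) - 3 / 4 * \<kappa> * (\<xi> t \<bullet> \<xi> t) - \<kappa> * (xs \<bullet> \<xi> t)
          - \<tau> / 2 * (adjoint A (\<nu> t) \<bullet> adjoint A (\<nu> t))
          + (\<tau> * K * g (x t) + \<tau> * K * (u t \<bullet> u t) + \<tau> * K * ((\<xi> t \<bullet> \<xi> t + 1) / a t))"
        using dE dW unfolding dF_def distrib_left by (simp add: mult.assoc)
      \<comment> \<open>The remaining quarter of \<open>\<eta>1\<close> and the last
        \<open>\<kappa> / 4\<close> are spent on the Tikhonov bound. One \<open>e / 2\<close> comes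
        from there, the other from the constant over \<open>a t\<close>.\<close>
      have "dF t + \<omega> * F t \<le> e"
        using 1 2 3 4 5 6 7 8 9 10 by linarith
      then have "w t * dF t \<le> w t * (e - \<omega> * F t)"
        using w_pos[OF tT] by (intro mult_left_mono) auto
      then show "w t * dF t \<le> w t * (\<omega> * (e / \<omega>) - \<omega> * F t)" using \<omega>(1) by simp
    qed (use \<omega>(1) e s_lim in auto)
    with eventually_ge_at_top[of T'] show ?thesis
    proof eventually_elim
      case (elim t)
      then show ?case using F_bounds(2)[of t] \<omega>(1) by (simp add: algebra_simps)
    qed
  qed
  show ?thesis
  proof (rule tendstoI)
    fix e :: real assume e: "0 < e"
    define C' where "C' = 2 / \<omega> + 1"
    have "0 < C'" unfolding C'_def using \<omega>(1) by (simp add: add_pos_pos)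
    then have "\<forall>\<^sub>F t in at_top. Q t \<le> e / 2"
      using main[of "e / 2 / C'", folded C'_def] e by simp
    then show "\<forall>\<^sub>F t in at_top. dist ((\<xi> t \<bullet> \<xi> t) / 4 + \<kappa> / (4 * \<gamma>) * (\<nu> t \<bullet> \<nu> t)) 0 < e"
    proof eventually_elim
      case (elim t)
      moreover have "0 \<le> Q t" unfolding Q_def using params by simp
      ultimately show ?case using e by (simp add: Q_def)
    qed
  qed
qed

lemma state_converges: "(x \<longlongrightarrow> xs) at_top"
proof -
  have "((\<lambda>t. (norm (x t - xs))\<^sup>2) \<longlongrightarrow> 0) at_top"
  proof (rule tendsto_0_le[OF lyapunov_convergence, where K=4])
    show "\<forall>\<^sub>F t in at_top. norm ((norm (x t - xs))\<^sup>2)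
        \<le> norm ((\<xi> t \<bullet> \<xi> t) / 4 + \<kappa> / (4 * \<gamma>) * (\<nu> t \<bullet> \<nu> t)) * 4"
      using params by (intro always_eventually allI) (simp add: \<xi>_def dot_square_norm[symmetric])
  qed
  then have "((\<lambda>t. sqrt ((norm (x t - xs))\<^sup>2)) \<longlongrightarrow> sqrt 0) at_top" by (rule tendsto_real_sqrt)
  then have "((\<lambda>t. x t - xs) \<longlongrightarrow> 0) at_top" by (simp add: tendsto_norm_zero_iff)
  then show ?thesis by (simp add: LIM_zero_iff)
qed

lemma multiplier_converges: "(\<nu> \<longlongrightarrow> 0) at_top"
proof -
  have "((\<lambda>t. (norm (\<nu> t))\<^sup>2) \<longlongrightarrow> 0) at_top"
  proof (rule tendsto_0_le[OF lyapunov_convergence, where K="4 * \<gamma> / \<kappa>"])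
    show "\<forall>\<^sub>F t in at_top. norm ((norm (\<nu> t))\<^sup>2)
        \<le> norm ((\<xi> t \<bullet> \<xi> t) / 4 + \<kappa> / (4 * \<gamma>) * (\<nu> t \<bullet> \<nu> t)) * (4 * \<gamma> / \<kappa>)"
      using params by (intro always_eventually allI) (simp add: dot_square_norm[symmetric] field_simps)
  qed
  then have "((\<lambda>t. sqrt ((norm (\<nu> t))\<^sup>2)) \<longlongrightarrow> sqrt 0) at_top" by (rule tendsto_real_sqrt)
  then show ?thesis by (simp add: tendsto_norm_zero_iff)
qed

end

section \<open>Convergence of the primal-dual flow\<close>

text \<open>Fixing one minimiser exposes the solution set as an intersection of closed convex sets,
  which is what the projection onto it requires.\<close>

lemma solution_set_eq_sublevel:
  assumes "y \<in> solution_set f A b"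
  shows "solution_set f A b = {x. A *v x = b} \<inter> {x. f x \<le> f y}"
  using assms by (fastforce simp: solution_set_def is_arg_min_linorder)

lemma closed_solution_set:
  assumes "continuous_on UNIV f"
  shows "closed (solution_set f A b)"
proof (cases "solution_set f A b = {}")
  case False
  then obtain y where y: "y \<in> solution_set f A b" by blast
  show ?thesis unfolding solution_set_eq_sublevel[OF y]
    by (intro closed_Int closed_Collect_eq closed_Collect_le continuous_intros assms
        linear_continuous_on) simp
qed simp

lemma convex_solution_set:
  assumes "convex_on UNIV f"
  shows "convex (solution_set f A b)"
proof (cases "solution_set f A b = {}")
  case False
  then obtain y where y: "y \<in> solution_set f A b" by blast
  have "convex {x. A *v x = b}"
    by (intro convexI) (simp add: matrix_vector_right_distrib matrix_vector_mult_scaleR scaleR_left_distrib[symmetric])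
  moreover have "convex {x. f x \<le> f y}"
  proof (rule convexI)
    fix x z and u v :: real
    assume *: "x \<in> {x. f x \<le> f y}" "z \<in> {x. f x \<le> f y}" "0 \<le> u" "0 \<le> v" "u + v = 1"
    then have "f (u *\<^sub>R x + v *\<^sub>R z) \<le> u * f x + v * f z"
      using assms by (simp add: convex_on_def)
    also have "\<dots> \<le> u * f y + v * f y" using * by (intro add_mono mult_left_mono) auto
    also have "\<dots> = f y" using * by (simp add: distrib_right[symmetric])
    finally show "u *\<^sub>R x + v *\<^sub>R z \<in> {x. f x \<le> f y}" by simp
  qed
  ultimately show ?thesis unfolding solution_set_eq_sublevel[OF y] by (rule convex_Int)
qed simp

lemma antimono_on_imp_deriv_nonpos:
  fixes f :: "real \<Rightarrow> real"
  assumes f: "antimono_on S f" and d: "(f has_real_derivative d) (at t)" and t: "t \<in> interior S"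
  shows "d \<le> 0"
proof -
  have "mono_on S (\<lambda>t. - f t)" using f by (auto simp: monotone_on_def)
  from mono_on_imp_deriv_nonneg[OF this DERIV_minus[OF d] t] show ?thesis by simp
qed

text \<open>The logarithmic derivative of \<open>a\<close> is \<open>w * p\<close>, so
  \<open>k * s - ln a\<close> is nondecreasing and the divergence of \<open>a\<close> carries over
  to \<open>s\<close>.\<close>

lemma integral_diverges_of_log_growth:
  fixes a s w p :: "real \<Rightarrow> real"
  assumes a: "\<And>t. T \<le> t \<Longrightarrow> (a has_real_derivative w t * (p t * a t)) (at t)"
    and s: "\<And>t. T \<le> t \<Longrightarrow> (s has_real_derivative w t) (at t)"
    and pos: "\<And>t. T \<le> t \<Longrightarrow> 0 < a t" "\<And>t. T \<le> t \<Longrightarrow> 0 \<le> w t" "0 < k"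
    and p: "\<And>t. T \<le> t \<Longrightarrow> p t \<le> k"
    and lim: "filterlim a at_top at_top"
  shows "filterlim s at_top at_top"
proof -
  define H where "H t = k * s t - ln (a t)" for t
  have "H T \<le> H t" if "T \<le> t" for t
  proof (rule DERIV_nonneg_imp_nondecreasing[OF that])
    fix r assume r: "T \<le> r" "r \<le> t"
    have "((\<lambda>t. ln (a t)) has_real_derivative w r * p r) (at r)"
      using DERIV_chain2[OF DERIV_ln_divide a[OF r(1)]] pos(1)[OF r(1)] by simp
    from DERIV_diff[OF DERIV_cmult[OF s[OF r(1)], of k] this]
    have "(H has_real_derivative (k - p r) * w r) (at r)"
      by (simp add: H_def[abs_def] algebra_simps)
    moreover have "0 \<le> (k - p r) * w r" using p pos r by simp
    ultimately show "\<exists>d. DERIV H r :> d \<and> 0 \<le> d" by blast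
  qed
  then have "\<forall>\<^sub>F t in at_top. (1 / k) * (H T + ln (a t)) \<le> s t"
    unfolding eventually_at_top_linorder using pos(3) by (intro exI[of _ T]) (simp add: H_def field_simps)
  moreover have "filterlim (\<lambda>t. (1 / k) * (H T + ln (a t))) at_top at_top"
    using pos(3)
    by (intro filterlim_tendsto_pos_mult_at_top[OF tendsto_const] filterlim_tendsto_add_at_top[OF tendsto_const]
        filterlim_compose[OF ln_at_top lim]) simp
  ultimately show ?thesis by (rule filterlim_at_top_mono[rotated])
qed

theorem theorem4p1:
  fixes t0 L \<delta> \<rho> \<sigma> \<gamma> sT \<eta>1 \<eta>2 :: real
    and f :: "real ^ 'n \<Rightarrow> real"
    and gradf :: "real ^ 'n \<Rightarrow> real ^ 'n"
    and A :: "real ^ 'n ^ 'm"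
    and b :: "real ^ 'm"
    and \<epsilon> \<beta> :: "real \<Rightarrow> real"
    and x :: "real \<Rightarrow> real ^ 'n"
    and lam :: "real \<Rightarrow> real ^ 'm"
    and xstar :: "real ^ 'n"
    and lamdag :: "real ^ 'm"
  assumes t0: "t0 > 0"
    and f_convex: "convex_on UNIV f"
    and f_grad: "\<And>z. GDERIV f z :> gradf z"
    and gradf_cont: "continuous_on UNIV gradf"
    and gradf_lipschitz: "L-lipschitz_on UNIV gradf"
    and L: "L > 0"
    and params: "\<delta> > 0" "\<rho> > 0" "\<sigma> > 0" "\<gamma> > 0"
    and eps_C2: "C2_on {t0..} \<epsilon>"
    and eps_pos: "\<And>t. t \<ge> t0 \<Longrightarrow> \<epsilon> t > 0"
    and eps_mono: "antimono_on {t0..} \<epsilon>"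
    and eps_lim: "(\<epsilon> \<longlongrightarrow> 0) at_top"
    and beta_nonneg: "\<And>t. t \<ge> t0 \<Longrightarrow> \<beta> t \<ge> 0"
    and beta_cont: "continuous_on {t0..} \<beta>"
    and beta_bounded: "bounded (\<beta> ` {t0..})"
    and S_nonempty: "solution_set f A b \<noteq> {}"
    and x_C2: "C2_on {t0..} x"
    and lam_C1: "C1_on {t0..} lam"
    and ode_x: "\<And>t. t \<ge> t0 \<Longrightarrow>
          deriv_on {t0..} (deriv_on {t0..} x) t
          + (\<delta> * sqrt (\<epsilon> t)) *\<^sub>R deriv_on {t0..} x t
          + gradf (x t + \<beta> t *\<^sub>R deriv_on {t0..} x t)
          + transpose A *v lam t
          + \<rho> *\<^sub>R (transpose A *v (A *v (x t + \<beta> t *\<^sub>R deriv_on {t0..} x t) - b))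
          + \<epsilon> t *\<^sub>R x t = 0"
    and ode_lam: "\<And>t. t \<ge> t0 \<Longrightarrow>
          deriv_on {t0..} lam t =
            (\<gamma> / sqrt (\<epsilon> t)) *\<^sub>R
              (A *v (x t + (\<gamma> / (\<sigma> * sqrt (\<epsilon> t))) *\<^sub>R deriv_on {t0..} x t) - b)"
    and xstar: "xstar = closest_point (solution_set f A b) 0"
    and lamdag_kkt: "gradf xstar + transpose A *v lamdag = 0"
    and lamdag_range: "lam t0 - lamdag \<in> range (\<lambda>z. A *v z)"
    and sT: "sT \<in> s_dom t0 \<epsilon>"
    and etas: "\<eta>1 > 0" "\<eta>2 > 0"
    and cond1: "\<And>s. s \<in> s_dom t0 \<epsilon> \<Longrightarrow> s \<ge> sT \<Longrightarrow>
          p_fun t0 \<epsilon> s < 2 * (\<delta> - \<sigma> / \<gamma>)"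
    and cond2: "\<And>s. s \<in> s_dom t0 \<epsilon> \<Longrightarrow> s \<ge> sT \<Longrightarrow>
          \<sigma> / \<gamma> - p_fun t0 \<epsilon> s \<ge> \<eta>1"
    and cond3: "\<And>s. s \<in> s_dom t0 \<epsilon> \<Longrightarrow> s \<ge> sT \<Longrightarrow>
          \<delta> - \<sigma> / \<gamma> - p_fun t0 \<epsilon> s / 2
            - \<sigma> * L / (2 * \<gamma>) * (\<beta> (t_of t0 \<epsilon> s))\<^sup>2 \<ge> \<eta>2"
    and cond4: "\<And>s. s \<in> s_dom t0 \<epsilon> \<Longrightarrow> s \<ge> sT \<Longrightarrow>
          \<sigma> / (4 * \<gamma>) * max (- p_deriv t0 \<epsilon> s) 0 \<le> (\<sigma> / \<gamma> + p_fun t0 \<epsilon> s) / 8"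
  shows "(x \<longlongrightarrow> xstar) at_top \<and> (lam \<longlongrightarrow> lamdag) at_top"
proof -
  have eps_diff: "\<epsilon> differentiable_on {t0..}" "deriv_on {t0..} \<epsilon> differentiable_on {t0..}"
    using eps_C2 by (auto simp: C2_on_def C1_on_def)
  have x_diff: "x differentiable_on {t0..}" "deriv_on {t0..} x differentiable_on {t0..}"
    using x_C2 by (auto simp: C2_on_def C1_on_def)
  have lam_diff: "lam differentiable_on {t0..}"
    using lam_C1 by (simp add: C1_on_def)
  define e1 e2 where "e1 = deriv_on {t0..} \<epsilon>" and "e2 = deriv_on {t0..} e1"
  define x1 x2 where "x1 = deriv_on {t0..} x" and "x2 = deriv_on {t0..} x1"
  define S where "S = solution_set f A b"
  interpret time_change t0 \<epsilon>
    using eps_diff(1) eps_pos by unfold_locales (auto intro: differentiable_imp_continuous_on)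
  have e_deriv: "(\<epsilon> has_real_derivative e1 t) (at t)" "(e1 has_real_derivative e2 t) (at t)" if "t0 < t" for t
    using deriv_on_at[OF eps_diff(1), of t] deriv_on_at[OF eps_diff(2), of t] that
    by (simp_all add: e1_def e2_def has_real_derivative_iff_has_vector_derivative)
  have x'_deriv: "(x has_vector_derivative x1 t) (at t)" "(x1 has_vector_derivative x2 t) (at t)" if "t0 < t" for t
    using deriv_on_at[OF x_diff(1), of t] deriv_on_at[OF x_diff(2), of t] that
    by (simp_all add: x1_def x2_def)
  have w_pos: "0 < w t" if "t0 \<le> t" for t using eps_pos[OF that] by simp
  have w_sq: "(w t)\<^sup>2 = \<epsilon> t" if "t0 \<le> t" for t using eps_pos[OF that] by simp
  have w_deriv: "(w has_real_derivative e1 t / (2 * w t)) (at t)" if "t0 < t" for t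
    using e_deriv[OF that] eps_pos[of t] that
    by (auto intro!: derivative_eq_intros simp: field_simps)

  define p where "p t = - e1 t / (w t)^3" for t
  define q where "q t = p_deriv t0 \<epsilon> (s t)" for t
  define a where "a t = 1 / \<epsilon> t" for t
  have a_deriv: "(a has_real_derivative w t * (p t * a t)) (at t)" if t: "t0 < t" for t
  proof -
    have "(a has_real_derivative - e1 t / (\<epsilon> t)\<^sup>2) (at t)"
      unfolding a_def[abs_def] using e_deriv[OF t] eps_pos[of t] t
      by (auto intro!: derivative_eq_intros simp: power2_eq_square)
    moreover have "- e1 t / (\<epsilon> t)\<^sup>2 = w t * (p t * a t)"
      using w_pos[of t] w_sq[of t, symmetric] t unfolding p_def a_def
      by (simp add: power2_eq_square power3_eq_cube field_simps del: real_sqrt_mult_self real_sqrt_pow2)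
    ultimately show ?thesis by simp
  qed
  have p_fun: "p_fun t0 \<epsilon> (s t) = p t" if t: "t0 < t" for t
  proof -
    have "deriv_on I (a_fun t0 \<epsilon>) (s t) = (1 / w t) *\<^sub>R (w t * (p t * a t))"
      using a_deriv[OF t] unfolding has_real_derivative_iff_has_vector_derivative
      by (rule deriv_on_s_dom[OF t]) (simp add: a_fun_def a_def t_of_s)
    then show ?thesis using w_pos[of t] eps_pos[of t] t
      by (simp add: p_fun_def a_fun_def a_def t_of_s)
  qed
  have p_deriv: "(p has_real_derivative w t * q t) (at t)" if t: "t0 < t" for t
  proof -
    \<comment> \<open>The quotient rule supplies existence; the value \<open>d\<close> is then
      identified with \<open>w t * q t\<close> through the time change.\<close>
    obtain d where d: "(p has_real_derivative d) (at t)"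
      using DERIV_divide[OF DERIV_minus[OF e_deriv(2)[OF t]] DERIV_power[OF w_deriv[OF t], of 3]] w_pos[of t] t
      unfolding p_def[abs_def] by auto
    have "q t = (1 / w t) *\<^sub>R d"
      unfolding q_def p_deriv_def using d p_fun
      by (intro deriv_on_s_dom[OF t]) (auto simp: has_real_derivative_iff_has_vector_derivative)
    then show ?thesis using d w_pos[of t] t by simp
  qed

  obtain tT where tT: "t0 \<le> tT" "sT = s tT" using sT unfolding s_dom_eq by auto
  \<comment> \<open>Lies strictly past \<open>t0\<close>, so that all derivatives from
    \<open>T\<close> onward are two-sided.\<close>
  define T where "T = max (t0 + 1) tT"
  have T: "t0 < t" if "T \<le> t" for t using that by (auto simp: T_def)
  have sT_le: "sT \<le> s t" "s t \<in> I" if "T \<le> t" for t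
    using s_less[OF tT(1), of t] that T[OF that] by (auto simp: tT(2) s_dom_eq T_def le_less)
  define \<kappa> where "\<kappa> = \<sigma> / \<gamma>"
  have \<kappa>: "0 < \<kappa>" using params by (simp add: \<kappa>_def)
  have p_bounds: "\<eta>1 \<le> \<kappa> - p t" "\<eta>2 \<le> \<delta> - \<kappa> - p t / 2 - \<kappa> * L / 2 * (\<beta> t)\<^sup>2"
      "\<kappa> / 4 * (- q t) \<le> (\<kappa> + p t) / 8" if t: "T \<le> t" for t
  proof -
    note le = sT_le(2)[OF t] sT_le(1)[OF t] and t' = T[OF t]
    show "\<eta>1 \<le> \<kappa> - p t" "\<eta>2 \<le> \<delta> - \<kappa> - p t / 2 - \<kappa> * L / 2 * (\<beta> t)\<^sup>2"
      using cond2[OF le] cond3[OF le] t' by (simp_all add: p_fun \<kappa>_def t_of_s)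
    have "\<kappa> / 4 * (- q t) \<le> \<kappa> / 4 * max (- q t) 0" using \<kappa> by (intro mult_left_mono) auto
    then show "\<kappa> / 4 * (- q t) \<le> (\<kappa> + p t) / 8"
      using cond4[OF le] t' by (simp add: p_fun \<kappa>_def q_def)
  qed
  have a_lim: "filterlim a at_top at_top"
    unfolding a_def[abs_def] inverse_eq_divide[symmetric]
    by (rule filterlim_inverse_at_top[OF eps_lim])
      (use eps_pos in \<open>auto simp: eventually_at_top_linorder\<close>)
  have s_lim: "filterlim s at_top at_top"
  proof (rule integral_diverges_of_log_growth[where T=T and a=a and w=w and p=p and k=\<kappa>])
    fix t assume t: "T \<le> t"
    show "p t \<le> \<kappa>" using p_bounds(1)[OF t] etas by linarith
    show "0 < a t" "0 \<le> w t" using T[OF t] eps_pos[of t] by (simp_all add: a_def)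
  qed (use T a_deriv s_deriv \<kappa> a_lim in auto)

  \<comment> \<open>The Lagrangian at the optimal multiplier\<close>
  have f_cont: "continuous_on UNIV f"
    using f_grad has_derivative_continuous unfolding gderiv_def continuous_on_eq_continuous_at[OF open_UNIV] by blast
  have S: "closed S" "convex S" "S \<noteq> {}"
    using closed_solution_set[OF f_cont] convex_solution_set[OF f_convex] S_nonempty by (simp_all add: S_def)
  have xstar_S: "xstar \<in> S" using closest_point_in_set[OF S(1,3)] by (simp add: xstar S_def)
  then have A_xstar: "A *v xstar = b" by (simp add: S_def solution_set_def is_arg_min_def)
  have A_diff: "A *v y - b = A *v (y - xstar)" for y
    by (simp add: matrix_vector_mult_diff_distrib A_xstar)
  have adj: "adjoint ((*v) A) y = transpose A *v y" for y by (simp add: adjoint_matrix)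
  have dot_A: "lamdag \<bullet> (A *v h) = h \<bullet> (transpose A *v lamdag)" for h
    using adjoint_works[OF matrix_vector_mul_linear, of h A lamdag] by (simp add: adj inner_commute)
  \<comment> \<open>The linear term vanishes on the feasible set, and stationarity makes
    \<open>xstar\<close> a global minimiser by convexity.\<close>
  define \<phi> where "\<phi> y = f y - f xstar + (y - xstar) \<bullet> (transpose A *v lamdag)" for y
  define G where "G y = gradf y + transpose A *v lamdag" for y
  have phi_grad: "GDERIV \<phi> y :> G y" for y
    using f_grad[of y] unfolding gderiv_def \<phi>_def[abs_def] G_def
    by (auto intro!: derivative_eq_intros simp: inner_add_right)
  have phi_convex: "convex_on UNIV \<phi>"
  proof (rule convex_onI)
    fix t y z assume t: "0 < t" "t < (1::real)"
    have "f ((1 - t) *\<^sub>R y + t *\<^sub>R z) \<le> (1 - t) * f y + t * f z"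
      using convex_onD[OF f_convex, of t] t by simp
    then show "\<phi> ((1 - t) *\<^sub>R y + t *\<^sub>R z) \<le> (1 - t) * \<phi> y + t * \<phi> z"
      by (simp add: \<phi>_def inner_add_left inner_diff_left algebra_simps)
  qed simp
  have phi_xstar: "\<phi> xstar = 0" by (simp add: \<phi>_def)
  have phi_nonneg: "0 \<le> \<phi> y" for y
    using convex_gradient_le[OF phi_convex phi_grad, of xstar y] lamdag_kkt by (simp add: phi_xstar G_def)
  \<comment> \<open>Such \<open>y\<close> are feasible with optimal value, hence solutions; the
    inequality is the variational characterisation of the projection of 0.\<close>
  have min_norm: "0 \<le> xstar \<bullet> (y - xstar)" if "\<phi> y = 0" "A *v (y - xstar) = 0" for y
  proof -
    have "f y = f xstar" using that(1) unfolding \<phi>_def dot_A[symmetric] that(2) by simp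
    moreover have "A *v y = b" using that(2) A_diff[of y] by simp
    ultimately have "y \<in> S" unfolding S_def solution_set_eq_sublevel[OF xstar_S[unfolded S_def]] by simp
    from closest_point_dot[OF S(2,1) this, of 0] show ?thesis by (simp add: xstar S_def)
  qed

  \<comment> \<open>The equations in rescaled time\<close>
  define u where "u t = (1 / w t) *\<^sub>R x1 t" for t
  have x1_u: "x1 t = w t *\<^sub>R u t" if "t0 \<le> t" for t using w_pos[OF that] by (simp add: u_def)
  define \<nu> where "\<nu> t = lam t - lamdag" for t
  \<comment> \<open>The derivative is taken within the half-line so as to include \<open>t0\<close>,
    where the multiplier error is known to lie in the range.\<close>
  have lam_deriv: "((\<lambda>t. lam t - lamdag) has_vector_derivative
      (w t * \<gamma> * a t) *\<^sub>R (A *v (x t - xstar + (1 / \<kappa>) *\<^sub>R u t))) (at t within {t0..})" if t: "t0 \<le> t" for t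
  proof -
    have "(lam has_vector_derivative deriv_on {t0..} lam t) (at t within {t0..})"
      using lam_diff t unfolding deriv_on_def differentiable_on_def by (simp add: vector_derivative_works)
    then have "((\<lambda>t. lam t - lamdag) has_vector_derivative deriv_on {t0..} lam t) (at t within {t0..})"
      using has_vector_derivative_diff[OF _ has_vector_derivative_const] by fastforce
    moreover have "\<gamma> / w t = w t * \<gamma> * a t"
      using w_pos[OF t] w_sq[OF t, symmetric] unfolding a_def
      by (simp add: power2_eq_square field_simps del: real_sqrt_mult_self real_sqrt_pow2)
    moreover have "x t + (\<gamma> / (\<sigma> * w t)) *\<^sub>R x1 t - xstar = x t - xstar + (1 / \<kappa>) *\<^sub>R u t"
      by (simp add: u_def \<kappa>_def)
    ultimately show ?thesis using ode_lam[OF t] by (simp add: A_diff x1_def diff_add_eq)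
  qed
  have nu_range: "\<nu> t \<in> range ((*v) A)" if "t0 \<le> t" for t
    unfolding \<nu>_def
  proof (rule stays_in_subspace[where g="\<lambda>t. lam t - lamdag", OF _ lamdag_range that lam_deriv])
    show V: "subspace (range ((*v) A))"
      by (rule linear_subspace_image[OF matrix_vector_mul_linear subspace_UNIV])
    show "(w r * \<gamma> * a r) *\<^sub>R (A *v (x r - xstar + (1 / \<kappa>) *\<^sub>R u r)) \<in> range ((*v) A)" for r
      by (rule subspace_scale[OF V]) simp
  qed
  have u_deriv: "(u has_vector_derivative
      - w t *\<^sub>R ((\<delta> - p t / 2) *\<^sub>R u t
        + a t *\<^sub>R (G (x t + (\<beta> t * w t) *\<^sub>R u t)
            + \<rho> *\<^sub>R adjoint ((*v) A) (A *v (x t + (\<beta> t * w t) *\<^sub>R u t - xstar)) + adjoint ((*v) A) (\<nu> t))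
        + x t)) (at t)" if t: "t0 < t" for t
  proof -
    have t': "t0 \<le> t" using t by simp
    define \<Phi> where "\<Phi> = gradf (x t + \<beta> t *\<^sub>R x1 t) + transpose A *v lam t
      + \<rho> *\<^sub>R (transpose A *v (A *v (x t + \<beta> t *\<^sub>R x1 t) - b))"
    have \<Phi>: "G (x t + (\<beta> t * w t) *\<^sub>R u t)
        + \<rho> *\<^sub>R adjoint ((*v) A) (A *v (x t + (\<beta> t * w t) *\<^sub>R u t - xstar)) + adjoint ((*v) A) (\<nu> t) = \<Phi>"
      unfolding \<Phi>_def A_diff x1_u[OF t'] adj G_def \<nu>_def
      by (simp add: matrix_vector_mult_diff_distrib)
    have "x2 t + ((\<delta> * w t) *\<^sub>R x1 t + \<Phi> + \<epsilon> t *\<^sub>R x t) = 0"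
      using ode_x[OF t'] by (simp add: \<Phi>_def x1_def x2_def add.assoc)
    then have "x2 t = - ((\<delta> * w t) *\<^sub>R x1 t + \<Phi> + \<epsilon> t *\<^sub>R x t)"
      by (rule eq_neg_iff_add_eq_0[THEN iffD2])
    then have x2: "x2 t = - (\<delta> * w t) *\<^sub>R x1 t - \<Phi> - \<epsilon> t *\<^sub>R x t"
      by simp
    \<comment> \<open>Since \<open>1 / w\<close> is the square root of \<open>a\<close>, its growth
      rate in rescaled time is \<open>p / 2\<close>; this is the reduction of the damping
      \<open>\<delta>\<close>.\<close>
    have "((\<lambda>t. 1 / w t) has_real_derivative p t / 2) (at t)"
      using DERIV_inverse'[OF w_deriv[OF t]] w_pos[OF t']
      by (simp add: inverse_eq_divide p_def power3_eq_cube mult_ac del: real_sqrt_mult_self)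
    from has_vector_derivative_scaleR[OF this x'_deriv(2)[OF t]]
    have "(u has_vector_derivative (1 / w t) *\<^sub>R x2 t + (p t / 2) *\<^sub>R x1 t) (at t)"
      by (simp add: u_def[abs_def])
    moreover have "(1 / w t) *\<^sub>R x2 t + (p t / 2) *\<^sub>R x1 t
        = - w t *\<^sub>R ((\<delta> - p t / 2) *\<^sub>R u t + a t *\<^sub>R \<Phi> + x t)"
    proof -
      have "(1 / W) *\<^sub>R (- (\<delta> * W) *\<^sub>R (W *\<^sub>R U) - V - W\<^sup>2 *\<^sub>R X) + (P / 2) *\<^sub>R (W *\<^sub>R U)
          = - W *\<^sub>R ((\<delta> - P / 2) *\<^sub>R U + (1 / W\<^sup>2) *\<^sub>R V + X)"
        if "0 < W" for W P and U V X :: "real ^ 'n"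
        using that by (simp add: power2_eq_square algebra_simps)
      from this[OF w_pos[OF t']] show ?thesis
        unfolding x2 x1_u[OF t'] w_sq[OF t'] a_def .
    qed
    ultimately show ?thesis unfolding \<Phi> by simp
  qed

  interpret rescaled_flow "(*v) A" \<phi> G xstar L \<rho> \<delta> \<kappa> \<gamma> \<eta>1 \<eta>2 T w a p q \<beta> s x u \<nu>
  proof (rule rescaled_flow.intro)
    show "linear ((*v) A)" by (rule matrix_vector_mul_linear)
    show "L-lipschitz_on UNIV G" unfolding G_def
      using lipschitz_on_add[OF gradf_lipschitz lipschitz_on_constant] by simp
    show "bounded (\<beta> ` {T..})"
      by (rule bounded_subset[OF beta_bounded]) (use T in force)
    show "(w \<longlongrightarrow> 0) at_top" using tendsto_real_sqrt[OF eps_lim] by simp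
    fix t assume t: "T \<le> t"
    note t' = T[OF t]
    have t'': "t0 \<le> t" using t' by simp
    show "(x has_vector_derivative w t *\<^sub>R u t) (at t)"
      using x'_deriv(1)[OF t'] by (simp add: x1_u[OF t''])
    show "(\<nu> has_vector_derivative (w t * \<gamma> * a t) *\<^sub>R (A *v (x t - xstar + (1 / \<kappa>) *\<^sub>R u t))) (at t)"
      using lam_deriv[OF t''] t' unfolding \<nu>_def[abs_def] by (simp add: at_within_interior[of t "{t0..}"])
    show "a t * (w t)\<^sup>2 = 1" using eps_pos[OF t''] by (simp add: a_def)
    \<comment> \<open>The monotonicity of \<open>\<epsilon>\<close> enters here: \<open>p\<close>
      has the opposite sign to its derivative.\<close>
    show "0 \<le> p t"
      using antimono_on_imp_deriv_nonpos[OF eps_mono e_deriv(1)[OF t']] w_pos[OF t''] t'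
      by (simp add: p_def divide_nonpos_pos)
  qed (use phi_convex phi_grad L phi_nonneg phi_xstar min_norm params \<kappa> etas u_deriv a_deriv p_deriv s_deriv
      w_pos s_lim beta_nonneg p_bounds nu_range T in \<open>auto simp: less_imp_le\<close>)
  have "(lam \<longlongrightarrow> lamdag) at_top"
    using multiplier_converges unfolding \<nu>_def by (simp add: LIM_zero_iff)
  with state_converges show ?thesis ..
qed

end
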